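(* Let $p\in[2,\infty)$. Let $s:\Omega\to\mathbb{R}$ be measurable with $s(x)\in[0,1]$ for almost all $x\in\Omega$ and with $|\{x\in\Omega: s(x)=0\}|=0$, and let $\mathrm{G}_s:\Omega\to\mathbb{R}$ be a weight with $\mathrm{G}_s^{-1/(p-1)}\in L^1_{\mathrm{loc}}(\Omega)$ such that, if $s(\cdot)=s\in(0,1)$ is constant, then $\mathrm{G}_s(x)=2^{2s-1}\Gamma(s)/\Gamma(1-s)$ for all $x\in\Omega$. Let $w(x,y)=\mathrm{G}_s(x)y^{1-2s(x)}$ and define $\tilde w:\Omega\to\mathbb{R}$ by $$\tilde w(x)=\mathrm{G}_s(x)\,(p-2+2s(x))^p .$$ Then there exists a unique bounded linear operator $$\mathrm{tr}_\Omega:\mathscr{H}_{0,L}^{1,p}(\mathcal{C},w)\to L^p(\Omega,\tilde w)$$ that satisfies $\mathrm{tr}_\Omega u=u(\cdot,0)$ for all $u\in\mathscr{H}_{0,L}^{1,p}(\mathcal{C},w)\cap C_c^\infty(\mathcal{C}_\Omega)$. The same statement is true if $\mathscr{H}_{0,L}^{1,p}(\mathcal{C},w)$ is replaced by $\mathscr{H}_{0,L}^{1,p}(\mathcal{C}^\tau,w)$ (with $C_c^\infty(\mathcal{C}_\Omega)$ replaced by $C_c^\infty(\mathcal{C}^\tau_\Omega)$), for every $\tau>0$.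
   Context: $\Omega\subset\mathbb{R}^N$, $N\ge1$, is a non-empty bounded open set with Lipschitz boundary. $\mathcal{C}=\Omega\times(0,\infty)$, $\partial_L\mathcal{C}=\partial\Omega\times[0,\infty)$, $\mathcal{C}_\Omega=\mathcal{C}\cup(\Omega\times\{0\})$. For $\tau>0$: $\mathcal{C}^\tau=\Omega\times(0,\tau)$ and $\mathcal{C}^\tau_\Omega=\mathcal{C}^\tau\cup(\Omega\times\{0\})$; the restriction of $w$ to $\mathcal{C}^\tau$ is again denoted $w$. Points are written $(x,y)$ with $x\in\Omega$, $y>0$. A weight is a measurable function that is positive and finite almost everywhere. For an open set $U$ and a weight $\rho$ on $U$, $L^p(U,\rho)$ is the space of measurable $u$ with $\|u\|_{L^p(U,\rho)}=(\int_U|u|^p\rho\,dx)^{1/p}<\infty$. If $\rho^{-1/(p-1)}\in L^1_{\mathrm{loc}}(U)$, $W^{1,p}(U,\rho)$ is the Banach space of $u\in L^p(U,\rho)$ with weak gradient satisfying $|\nabla u|\in L^p(U,\rho)$, normed by $(\int_U|u|^p\rho+\int_U|\nabla u|^p\rho)^{1/p}$. $C_c^\infty(\mathcal{C}_\Omega)$ is the set of $u\in C^\infty(\overline{\mathcal{C}})$ with compact support in $\mathcal{C}_\Omega$ (so the support does not meet $\partial_L\mathcal{C}$, while $u$ need not vanish on $\Omega\times\{0\}$); $C_c^\infty(\mathcal{C}^\tau_\Omega)$ is defined analogously with $\mathcal{C}^\tau$. $\mathscr{H}_{0,L}^{1,p}(\mathcal{C},w)$ is the closure of $C_c^\infty(\mathcal{C}_\Omega)\cap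 W^{1,p}(\mathcal{C},w)$ in $W^{1,p}(\mathcal{C},w)$, and $\mathscr{H}_{0,L}^{1,p}(\mathcal{C}^\tau,w)$ is the closure of $C_c^\infty(\mathcal{C}^\tau_\Omega)\cap W^{1,p}(\mathcal{C}^\tau,w)$ in $W^{1,p}(\mathcal{C}^\tau,w)$. *)

theory Defs
  imports "HOL-Analysis.Analysis"
begin

definition lipschitz_boundary :: "'a::euclidean_space set \<Rightarrow> bool" where
  "lipschitz_boundary \<Omega> \<longleftrightarrow>
     (\<forall>x0\<in>frontier \<Omega>. \<exists>r>0. \<exists>e \<gamma> L.
        norm e = 1 \<and> L-lipschitz_on {v. v \<bullet> e = 0} \<gamma> \<and>
        \<Omega> \<inter> ball x0 r = {x \<in> ball x0 r. \<gamma> (x - (x \<bullet> e) *\<^sub>R e) < x \<bullet> e})"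
  (* Near each boundary point the set is the strict epigraph, in the direction e, of a
     Lipschitz function on the hyperplane orthogonal to e. In dimension one that hyperplane
     is {0}, so the condition says that the set is locally a one-sided interval. *)

fun iter_deriv :: "'a::euclidean_space list \<Rightarrow> ('a \<Rightarrow> real) \<Rightarrow> 'a \<Rightarrow> real" where
  "iter_deriv [] f = f"
| "iter_deriv (i # is) f = (\<lambda>x. frechet_derivative (iter_deriv is f) (at x) i)"

definition smooth_on :: "'a::euclidean_space set \<Rightarrow> ('a \<Rightarrow> real) \<Rightarrow> bool" where
  "smooth_on U f \<longleftrightarrow>
     (\<forall>is\<in>lists Basis. \<forall>x\<in>U. iter_deriv is f differentiable (at x))"

(* The space of smooth functions on the closure of the open set U: every partial derivative,
   of order zero included, extends continuously from U to the closure. A function is total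
   here; its values on the boundary of U are those of the continuous extension, and its
   values off the closure are never looked at. *)
definition smooth_on_closure :: "'a::euclidean_space set \<Rightarrow> ('a \<Rightarrow> real) \<Rightarrow> bool" where
  "smooth_on_closure U f \<longleftrightarrow>
     smooth_on U f \<and> continuous_on (closure U) f \<and>
     (\<forall>is\<in>lists Basis. \<exists>g. continuous_on (closure U) g \<and> (\<forall>x\<in>U. g x = iter_deriv is f x))"

definition compact_support_in ::
  "'a::euclidean_space set \<Rightarrow> 'a set \<Rightarrow> ('a \<Rightarrow> real) \<Rightarrow> bool" where
  "compact_support_in D K f \<longleftrightarrow>
     compact (closure {x \<in> D. f x \<noteq> 0}) \<and> closure {x \<in> D. f x \<noteq> 0} \<subseteq> K"

definition test_functions :: "'a::euclidean_space set \<Rightarrow> ('a \<Rightarrow> real) set" where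
  "test_functions U = {\<phi>. smooth_on U \<phi> \<and> compact_support_in U U \<phi>}"

(* For U \<subseteq> K \<subseteq> closure U: functions smooth up to the boundary of U whose support is a
   compact subset of K. *)
definition test_functions_upto ::
  "'a::euclidean_space set \<Rightarrow> 'a set \<Rightarrow> ('a \<Rightarrow> real) set" where
  "test_functions_upto U K = {u. smooth_on_closure U u \<and> compact_support_in (closure U) K u}"

definition weight :: "'a::euclidean_space set \<Rightarrow> ('a \<Rightarrow> real) \<Rightarrow> bool" where
  "weight U \<rho> \<longleftrightarrow>
     \<rho> \<in> borel_measurable (lebesgue_on U) \<and> (AE x in lebesgue_on U. 0 < \<rho> x)"

definition locally_integrable ::
  "'a::euclidean_space set \<Rightarrow> ('a \<Rightarrow> 'b::euclidean_space) \<Rightarrow> bool" where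
  "locally_integrable U f \<longleftrightarrow> (\<forall>K. compact K \<and> K \<subseteq> U \<longrightarrow> set_integrable lebesgue K f)"

(* The spaces below are sets of functions, not of classes modulo equality almost everywhere.
   Norms, and the notion of operator at the end, are invariant under that equality. *)

definition Lp :: "'a::euclidean_space set \<Rightarrow> real \<Rightarrow> ('a \<Rightarrow> real) \<Rightarrow> ('a \<Rightarrow> real) set" where
  "Lp U p \<rho> = {u. u \<in> borel_measurable (lebesgue_on U) \<and>
                  integrable (lebesgue_on U) (\<lambda>x. \<bar>u x\<bar> powr p * \<rho> x)}"

definition Lp_norm ::
  "'a::euclidean_space set \<Rightarrow> real \<Rightarrow> ('a \<Rightarrow> real) \<Rightarrow> ('a \<Rightarrow> real) \<Rightarrow> real" where
  "Lp_norm U p \<rho> u = (LINT x|lebesgue_on U. \<bar>u x\<bar> powr p * \<rho> x) powr (1 / p)"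

definition has_weak_gradient ::
  "'a::euclidean_space set \<Rightarrow> ('a \<Rightarrow> real) \<Rightarrow> ('a \<Rightarrow> 'a) \<Rightarrow> bool" where
  "has_weak_gradient U u g \<longleftrightarrow>
     locally_integrable U u \<and> locally_integrable U g \<and>
     (\<forall>\<phi>\<in>test_functions U. \<forall>i\<in>Basis.
        (LINT x|lebesgue_on U. u x * frechet_derivative \<phi> (at x) i) =
        - (LINT x|lebesgue_on U. (g x \<bullet> i) * \<phi> x))"

definition weak_gradient ::
  "'a::euclidean_space set \<Rightarrow> ('a \<Rightarrow> real) \<Rightarrow> 'a \<Rightarrow> 'a" where
  "weak_gradient U u = (SOME g. has_weak_gradient U u g)"

(* Used only for weights \<rho> with \<rho> powr (- 1 / (p - 1)) locally integrable on U, which makes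
   every element of Lp U p \<rho> locally integrable. *)
definition sobolev ::
  "'a::euclidean_space set \<Rightarrow> real \<Rightarrow> ('a \<Rightarrow> real) \<Rightarrow> ('a \<Rightarrow> real) set" where
  "sobolev U p \<rho> = {u \<in> Lp U p \<rho>.
     \<exists>g. has_weak_gradient U u g \<and> (\<lambda>x. norm (g x)) \<in> Lp U p \<rho>}"

definition sobolev_norm ::
  "'a::euclidean_space set \<Rightarrow> real \<Rightarrow> ('a \<Rightarrow> real) \<Rightarrow> ('a \<Rightarrow> real) \<Rightarrow> real" where
  "sobolev_norm U p \<rho> u =
     ((LINT x|lebesgue_on U. \<bar>u x\<bar> powr p * \<rho> x) +
      (LINT x|lebesgue_on U. norm (weak_gradient U u x) powr p * \<rho> x)) powr (1 / p)"

definition sobolev_closure ::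
  "'a::euclidean_space set \<Rightarrow> 'a set \<Rightarrow> real \<Rightarrow> ('a \<Rightarrow> real) \<Rightarrow> ('a \<Rightarrow> real) set" where
  "sobolev_closure U K p \<rho> = {u \<in> sobolev U p \<rho>.
     \<forall>\<epsilon>>0. \<exists>v \<in> test_functions_upto U K \<inter> sobolev U p \<rho>.
       sobolev_norm U p \<rho> (\<lambda>x. u x - v x) < \<epsilon>}"

definition cylinder :: "'a::euclidean_space set \<Rightarrow> ('a \<times> real) set" where
  "cylinder \<Omega> = \<Omega> \<times> {0<..}"

definition cylinder_base :: "'a::euclidean_space set \<Rightarrow> ('a \<times> real) set" where
  "cylinder_base \<Omega> = cylinder \<Omega> \<union> \<Omega> \<times> {0}"

definition trunc_cylinder :: "'a::euclidean_space set \<Rightarrow> real \<Rightarrow> ('a \<times> real) set" where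
  "trunc_cylinder \<Omega> \<tau> = \<Omega> \<times> {0<..<\<tau>}"

definition trunc_cylinder_base :: "'a::euclidean_space set \<Rightarrow> real \<Rightarrow> ('a \<times> real) set" where
  "trunc_cylinder_base \<Omega> \<tau> = trunc_cylinder \<Omega> \<tau> \<union> \<Omega> \<times> {0}"

definition H0L ::
  "'a::euclidean_space set \<Rightarrow> real \<Rightarrow> ('a \<times> real \<Rightarrow> real) \<Rightarrow> ('a \<times> real \<Rightarrow> real) set" where
  "H0L \<Omega> p w = sobolev_closure (cylinder \<Omega>) (cylinder_base \<Omega>) p w"

definition H0L_trunc ::
  "'a::euclidean_space set \<Rightarrow> real \<Rightarrow> real \<Rightarrow> ('a \<times> real \<Rightarrow> real) \<Rightarrow> ('a \<times> real \<Rightarrow> real) set" where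
  "H0L_trunc \<Omega> \<tau> p w = sobolev_closure (trunc_cylinder \<Omega> \<tau>) (trunc_cylinder_base \<Omega> \<tau>) p w"

(* A bounded linear operator from a space X of functions on U, normed by NX, to the space
   Lp V p \<rho>, both modulo equality almost everywhere. *)
definition bounded_linear_Lp ::
  "'b::euclidean_space set \<Rightarrow> ('b \<Rightarrow> real) set \<Rightarrow> (('b \<Rightarrow> real) \<Rightarrow> real) \<Rightarrow>
   'a::euclidean_space set \<Rightarrow> real \<Rightarrow> ('a \<Rightarrow> real) \<Rightarrow> (('b \<Rightarrow> real) \<Rightarrow> ('a \<Rightarrow> real)) \<Rightarrow> bool" where
  "bounded_linear_Lp U X NX V p \<rho> T \<longleftrightarrow>
     (\<forall>u\<in>X. T u \<in> Lp V p \<rho>) \<and>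
     (\<forall>u\<in>X. \<forall>v\<in>X. (AE z in lebesgue_on U. u z = v z) \<longrightarrow>
        (AE x in lebesgue_on V. T u x = T v x)) \<and>
     (\<forall>u\<in>X. \<forall>v\<in>X. AE x in lebesgue_on V. T (\<lambda>z. u z + v z) x = T u x + T v x) \<and>
     (\<forall>c. \<forall>u\<in>X. AE x in lebesgue_on V. T (\<lambda>z. c * u z) x = c * T u x) \<and>
     (\<exists>C. \<forall>u\<in>X. Lp_norm V p \<rho> (T u) \<le> C * NX u)"

definition trace_operator ::
  "'a::euclidean_space set \<Rightarrow> real \<Rightarrow> ('a \<times> real \<Rightarrow> real) \<Rightarrow> ('a \<Rightarrow> real) \<Rightarrow>
   (('a \<times> real \<Rightarrow> real) \<Rightarrow> ('a \<Rightarrow> real)) \<Rightarrow> bool" where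
  "trace_operator \<Omega> p w w' T \<longleftrightarrow>
     bounded_linear_Lp (cylinder \<Omega>) (H0L \<Omega> p w) (sobolev_norm (cylinder \<Omega>) p w) \<Omega> p w' T \<and>
     (\<forall>u \<in> H0L \<Omega> p w \<inter> test_functions_upto (cylinder \<Omega>) (cylinder_base \<Omega>).
        AE x in lebesgue_on \<Omega>. T u x = u (x, 0))"

definition trunc_trace_operator ::
  "'a::euclidean_space set \<Rightarrow> real \<Rightarrow> real \<Rightarrow> ('a \<times> real \<Rightarrow> real) \<Rightarrow> ('a \<Rightarrow> real) \<Rightarrow>
   (('a \<times> real \<Rightarrow> real) \<Rightarrow> ('a \<Rightarrow> real)) \<Rightarrow> bool" where
  "trunc_trace_operator \<Omega> \<tau> p w w' T \<longleftrightarrow>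
     bounded_linear_Lp (trunc_cylinder \<Omega> \<tau>) (H0L_trunc \<Omega> \<tau> p w)
       (sobolev_norm (trunc_cylinder \<Omega> \<tau>) p w) \<Omega> p w' T \<and>
     (\<forall>u \<in> H0L_trunc \<Omega> \<tau> p w \<inter>
           test_functions_upto (trunc_cylinder \<Omega> \<tau>) (trunc_cylinder_base \<Omega> \<tau>).
        AE x in lebesgue_on \<Omega>. T u x = u (x, 0))"

end

theory Submission
  imports Defs
begin

text \<open>
  Everything rests on one estimate. On a vertical line over a point \<open>x\<close> of \<open>\<Omega>\<close> the weight is
  \<open>G x * y powr (1 - 2 * s x)\<close>. Put \<open>\<kappa> = p - 2 + 2 * s x\<close>. For a smooth function \<open>f\<close> of \<open>y\<close>,
  \<open>\<bar>f 0\<bar> \<le> \<bar>f y\<bar> + I\<close> where \<open>I\<close> is the integral of \<open>\<bar>f'\<bar>\<close> over an interval \<open>(0, h)\<close>. The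
  inequality of Hoelder, with the dual weight \<open>t powr ((2 * s x - 1) / (p - 1))\<close>, bounds
  \<open>I powr p\<close> by a constant times \<open>\<kappa> powr (1 - p)\<close> times the weighted integral of
  \<open>\<bar>f'\<bar> powr p\<close>. The dual weight is integrable at \<open>0\<close> precisely when \<open>\<kappa> > 0\<close>, which
  \<open>p \<ge> 2\<close> and \<open>s x > 0\<close> ensure. Averaging over \<open>y\<close> gives
  \<open>\<bar>f 0\<bar> powr p * \<kappa> powr p \<le> C * \<integral> (\<bar>f\<bar> powr p + \<bar>f'\<bar> powr p) * y powr (1 - 2 * s x)\<close>
  with \<open>C\<close> depending on \<open>p\<close> and \<open>h\<close> only (\<open>one_dim_trace\<close>): the factor \<open>\<kappa> powr p\<close> in the target
  weight absorbs the degeneration as \<open>\<kappa>\<close> tends to \<open>0\<close>. Multiplying by \<open>G x\<close> and integrating over \<open>\<Omega>\<close>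
  turns this into the trace inequality for smooth functions (\<open>trace_inequality\<close>).

  Since the smooth functions are dense by definition of the space, the trace extends uniquely by
  continuity and by the completeness of \<open>L\<^sup>p\<close>. The functions are not identified modulo null
  sets here, so the extension \<open>t\<close> of \<open>u\<close> is singled out, up to a null set, by the inequality
  \<open>\<parallel>t - tr v\<parallel> \<le> B * \<parallel>u - v\<parallel>\<close> for all smooth \<open>v\<close>; linearity, compatibility with equality almost
  everywhere, and uniqueness of the operator all follow from this characterization
  (\<open>extends_trace_combination\<close>, \<open>unique_extension\<close>). Instead of norms, the argument handles their
  \<open>p\<close>-th powers, for which the elementary bound \<open>(a + b) powr p \<le> 2 powr p * (a powr p + b powr p)\<close>
  replaces the triangle inequality.

  Two facts about weak gradients connect the two halves: a weak gradient is unique almost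
  everywhere, so that the Sobolev norm does not depend on the one chosen, and for a smooth
  function it is the classical gradient. Both come from the fundamental lemma of the calculus of variations and
  integration by parts against test functions.

  The estimate on a vertical line uses a bounded interval above the base only. So the infinite and
  the truncated cylinder are treated together, as products \<open>\<Omega> \<times> T\<close> in which the open set \<open>T\<close> of
  positive reals contains an interval \<open>(0, h]\<close>.
\<close>

section \<open>Smooth bumps and the fundamental lemma of the calculus of variations\<close>

text \<open>
  The powers of \<open>t\<close> in the denominator make the family closed under differentiation.
\<close>

definition flat_exp :: "nat \<Rightarrow> real \<Rightarrow> real" where
  "flat_exp m t = (if 0 < t then exp (- 1 / t) / t ^ m else 0)"

text \<open>
  Substituting \<open>u = 1 / t\<close>, this is the fact that \<open>exp u\<close> outgrows every power of \<open>u\<close>.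
\<close>

lemma flat_exp_at_right: "(flat_exp m \<longlongrightarrow> 0) (at_right 0)"
proof -
  have "((\<lambda>u::real. u ^ m / exp u) \<longlongrightarrow> 0) at_top"
    by (rule tendsto_power_div_exp_0)
  then have "((\<lambda>t::real. inverse t ^ m / exp (inverse t)) \<longlongrightarrow> 0) (at_right 0)"
    by (rule filterlim_compose) (rule filterlim_inverse_at_top_right)
  then show ?thesis
  proof (rule Lim_transform_eventually)
    show "\<forall>\<^sub>F t in at_right 0. inverse t ^ m / exp (inverse t) = flat_exp m t"
      unfolding eventually_at_right_field
      by (intro exI[of _ 1]) (auto simp: flat_exp_def field_simps exp_minus)
  qed
qed

lemma flat_exp_tendsto_0: "(flat_exp m \<longlongrightarrow> 0) (at 0)"
proof -
  have "(flat_exp m \<longlongrightarrow> 0) (at_left 0)"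
    by (rule Lim_transform_eventually[OF tendsto_const])
       (auto simp: eventually_at_left_field flat_exp_def intro!: exI[of _ "-1"])
  then show ?thesis
    using flat_exp_at_right filterlim_split_at by blast
qed

text \<open>
  At \<open>0\<close> the difference quotient of \<open>flat_exp m\<close> is \<open>flat_exp (m + 1)\<close>, which tends to \<open>0\<close>.
\<close>

lemma has_real_derivative_flat_exp:
  "(flat_exp m has_real_derivative flat_exp (m + 2) t - m * flat_exp (m + 1) t) (at t)"
proof -
  consider "t < 0" | "t = 0" | "0 < t" by linarith
  then show ?thesis
  proof cases
    case 1
    have "((\<lambda>_. 0) has_real_derivative 0) (at t)" by simp
    then have "(flat_exp m has_real_derivative 0) (at t)"
      by (rule has_field_derivative_transform_within_open[of _ _ _ "{..<0}"])
         (use 1 in \<open>auto simp: flat_exp_def\<close>)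
    with 1 show ?thesis by (simp add: flat_exp_def)
  next
    case 2
    have "((\<lambda>h. (flat_exp m h - flat_exp m 0) / (h - 0)) \<longlongrightarrow> 0) (at 0)"
      by (rule Lim_transform_eventually[OF flat_exp_tendsto_0[of "Suc m"]])
         (auto simp: eventually_at_filter flat_exp_def field_simps)
    then show ?thesis
      using 2 by (simp add: has_field_derivative_iff flat_exp_def)
  next
    case 3
    have "((\<lambda>t. exp (- 1 / t) / t ^ m) has_real_derivative
            flat_exp (m + 2) t - m * flat_exp (m + 1) t) (at t)"
      using 3 by (auto intro!: derivative_eq_intros
        simp: flat_exp_def field_simps power2_eq_square power_diff split: nat_diff_split)
    then show ?thesis
      by (rule has_field_derivative_transform_within_open[of _ _ _ "{0<..}"])
         (use 3 in \<open>auto simp: flat_exp_def\<close>)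
  qed
qed

text \<open>
  An algebra of functions closed under partial derivatives consists of smooth functions. This
  one is large enough to contain bumps supported in arbitrary boxes.
\<close>

inductive_set flat_exp_algebra :: "('a::euclidean_space \<Rightarrow> real) set" where
  const: "(\<lambda>_. c) \<in> flat_exp_algebra"
| flat: "(\<lambda>x. flat_exp m (c * (x \<bullet> v) + d)) \<in> flat_exp_algebra"
| add: "f \<in> flat_exp_algebra \<Longrightarrow> g \<in> flat_exp_algebra \<Longrightarrow> (\<lambda>x. f x + g x) \<in> flat_exp_algebra"
| mult: "f \<in> flat_exp_algebra \<Longrightarrow> g \<in> flat_exp_algebra \<Longrightarrow> (\<lambda>x. f x * g x) \<in> flat_exp_algebra"

lemma flat_exp_algebra_derivative:
  assumes "f \<in> flat_exp_algebra"
  shows "\<exists>f'. (\<forall>x. (f has_derivative f' x) (at x)) \<and> (\<forall>i. (\<lambda>x. f' x i) \<in> flat_exp_algebra)"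
  using assms
proof induction
  case (const c)
  show ?case
    by (rule exI[of _ "\<lambda>_ _. 0"]) (auto intro: flat_exp_algebra.const)
next
  case (flat m c v d)
  let ?l = "\<lambda>x. c * (x \<bullet> v) + d"
  let ?f' = "\<lambda>x h. (flat_exp (m + 2) (?l x) + (- real m) * flat_exp (m + 1) (?l x)) * (c * (h \<bullet> v))"
  have "((\<lambda>x. flat_exp m (?l x)) has_derivative ?f' x) (at x)" for x
  proof -
    have "(?l has_derivative (\<lambda>h. c * (h \<bullet> v))) (at x)"
      by (auto intro!: derivative_eq_intros)
    moreover have "(flat_exp m has_derivative
        (\<lambda>h. (flat_exp (m + 2) (?l x) - real m * flat_exp (m + 1) (?l x)) * h)) (at (?l x))"
      using has_real_derivative_flat_exp[of m "?l x"] by (simp add: has_field_derivative_def)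
    ultimately show ?thesis
      using has_derivative_compose[of ?l _ x UNIV] by (fastforce simp: algebra_simps)
  qed
  moreover have "(\<lambda>x. ?f' x i) \<in> flat_exp_algebra" for i
    by (intro flat_exp_algebra.intros)
  ultimately show ?case by (intro exI[of _ ?f']) blast
next
  case (add f g)
  then obtain f' g' where "\<And>x. (f has_derivative f' x) (at x)" "\<And>x. (g has_derivative g' x) (at x)"
    "\<And>i. (\<lambda>x. f' x i) \<in> flat_exp_algebra" "\<And>i. (\<lambda>x. g' x i) \<in> flat_exp_algebra" by metis
  then show ?case
    by (intro exI[of _ "\<lambda>x h. f' x h + g' x h"])
       (auto intro: derivative_intros flat_exp_algebra.add)
next
  case (mult f g)
  then obtain f' g' where *: "\<And>x. (f has_derivative f' x) (at x)" "\<And>x. (g has_derivative g' x) (at x)"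
    "\<And>i. (\<lambda>x. f' x i) \<in> flat_exp_algebra" "\<And>i. (\<lambda>x. g' x i) \<in> flat_exp_algebra" by metis
  have "((\<lambda>x. f x * g x) has_derivative (\<lambda>h. f x * g' x h + f' x h * g x)) (at x)" for x
    by (rule has_derivative_mult) (fact *)+
  moreover have "(\<lambda>x. f x * g' x i + f' x i * g x) \<in> flat_exp_algebra" for i
    by (intro flat_exp_algebra.add flat_exp_algebra.mult mult.hyps *)
  ultimately show ?case
    by (intro exI[of _ "\<lambda>x h. f x * g' x h + f' x h * g x"]) blast
qed

lemma iter_deriv_flat_exp_algebra:
  "f \<in> flat_exp_algebra \<Longrightarrow> iter_deriv is f \<in> flat_exp_algebra"
proof (induction "is")
  case (Cons i "is")
  then obtain f' where "\<And>x. (iter_deriv is f has_derivative f' x) (at x)"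
    "(\<lambda>x. f' x i) \<in> flat_exp_algebra"
    using flat_exp_algebra_derivative by metis
  moreover from this(1) have "frechet_derivative (iter_deriv is f) (at x) = f' x" for x
    by (metis frechet_derivative_at)
  ultimately show ?case by simp
qed auto

lemma smooth_on_flat_exp_algebra: "f \<in> flat_exp_algebra \<Longrightarrow> smooth_on U f"
  unfolding smooth_on_def differentiable_def
  using iter_deriv_flat_exp_algebra flat_exp_algebra_derivative by metis

text \<open>
  The factor \<open>Suc k\<close> sharpens the bump: as \<open>k\<close> grows, \<open>exp (- 1 / (Suc k * t))\<close> increases to \<open>1\<close>
  for every \<open>t > 0\<close>, so that the bumps converge to the indicator function of the open box.
\<close>

definition box_bump :: "'a::euclidean_space \<Rightarrow> 'a \<Rightarrow> nat \<Rightarrow> 'a \<Rightarrow> real" where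
  "box_bump a b k x = (\<Prod>i\<in>Basis. flat_exp 0 (real (Suc k) * (x \<bullet> i - a \<bullet> i)) *
                                   flat_exp 0 (real (Suc k) * (b \<bullet> i - x \<bullet> i)))"

lemma box_bump_flat_exp_algebra: "box_bump a b k \<in> flat_exp_algebra"
proof -
  have 1: "(\<lambda>x. flat_exp 0 (real (Suc k) * (x \<bullet> i - a \<bullet> i))) \<in> flat_exp_algebra" for i
    using flat_exp_algebra.flat[of 0 "real (Suc k)" i "- (real (Suc k) * (a \<bullet> i))"]
    by (simp add: algebra_simps)
  have 2: "(\<lambda>x. flat_exp 0 (real (Suc k) * (b \<bullet> i - x \<bullet> i))) \<in> flat_exp_algebra" for i
    using flat_exp_algebra.flat[of 0 "- real (Suc k)" i "real (Suc k) * (b \<bullet> i)"]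
    by (simp add: algebra_simps)
  have "(\<lambda>x. \<Prod>i\<in>I. flat_exp 0 (real (Suc k) * (x \<bullet> i - a \<bullet> i)) *
                 flat_exp 0 (real (Suc k) * (b \<bullet> i - x \<bullet> i))) \<in> flat_exp_algebra"
    if "finite I" for I
    using that
    by induction (auto simp del: of_nat_Suc intro!: flat_exp_algebra.const flat_exp_algebra.mult 1 2)
  then show ?thesis
    by (simp add: box_bump_def[abs_def])
qed

lemma box_bump_eq_0: "x \<notin> box a b \<Longrightarrow> box_bump a b k x = 0"
  by (force simp: box_bump_def mem_box flat_exp_def not_less zero_less_mult_iff)

lemma box_bump_nonneg: "0 \<le> box_bump a b k x"
  by (auto simp: box_bump_def flat_exp_def intro!: prod_nonneg)

lemma box_bump_le_1: "box_bump a b k x \<le> 1"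
  unfolding box_bump_def
  by (rule prod_le_1) (auto simp: flat_exp_def intro!: mult_le_one)

lemma box_bump_tendsto: "(\<lambda>k. box_bump a b k x) \<longlonglongrightarrow> indicator (box a b) x"
proof (cases "x \<in> box a b")
  case True
  have *: "(\<lambda>k. flat_exp 0 (real (Suc k) * t)) \<longlonglongrightarrow> 1" if "0 < t" for t
  proof -
    have "(\<lambda>k. - (inverse (real (Suc k)) / t)) \<longlonglongrightarrow> - (0 / t)"
      by (intro tendsto_intros LIMSEQ_inverse_real_of_nat) (use that in auto)
    then have "(\<lambda>k. exp (- (inverse (real (Suc k)) / t))) \<longlonglongrightarrow> exp 0"
      by (intro tendsto_intros) auto
    moreover have "flat_exp 0 (real (Suc k) * t) = exp (- (inverse (real (Suc k)) / t))" for k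
      using that by (simp add: flat_exp_def zero_less_mult_iff divide_simps)
    ultimately show ?thesis by simp
  qed
  have "(\<lambda>k. box_bump a b k x) \<longlonglongrightarrow> (\<Prod>i\<in>(Basis::'a set). 1 * 1)"
    unfolding box_bump_def using True
    by (intro tendsto_prod tendsto_mult *) (auto simp: mem_box)
  with True show ?thesis by simp
qed (simp add: box_bump_eq_0)

lemma box_bump_test_function:
  assumes "cbox a b \<subseteq> U"
  shows "box_bump a b k \<in> test_functions U"
proof -
  have "closure {x \<in> U. box_bump a b k x \<noteq> 0} \<subseteq> cbox a b"
    by (rule closure_minimal) (use box_bump_eq_0 box_subset_cbox in blast)+
  moreover from this have "compact (closure {x \<in> U. box_bump a b k x \<noteq> 0})"
    by (meson bounded_cbox bounded_subset closed_closure compact_eq_bounded_closed)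
  ultimately show ?thesis
    using assms smooth_on_flat_exp_algebra[OF box_bump_flat_exp_algebra]
    unfolding test_functions_def compact_support_in_def by blast
qed

lemma continuous_on_box_bump: "continuous_on S (box_bump a b k)"
  using flat_exp_algebra_derivative[OF box_bump_flat_exp_algebra]
  by (metis continuous_at_imp_continuous_on has_derivative_continuous)

text \<open>
  By Lebesgue differentiation, almost every value of \<open>f\<close> is a limit of averages over small
  boxes.
\<close>

lemma AE_zero_if_box_integrals_zero:
  fixes f :: "'a::euclidean_space \<Rightarrow> real"
  assumes "integrable lebesgue f" and "\<And>a b. (LINT x:cbox a b|lebesgue. f x) = 0"
  shows "AE x in lebesgue. f x = 0"
proof -
  have int: "f absolutely_integrable_on cbox a b" for a b
    unfolding set_integrable_def using assms(1) by (intro integrable_mult_indicator) auto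
  then have zero: "integral (cbox a b) f = 0" for a b
    using assms(2) set_lebesgue_integral_eq_integral(2) by metis
  obtain N where N: "negligible N"
    "\<And>x e. x \<notin> N \<Longrightarrow> 0 < e \<Longrightarrow> \<exists>d>0. \<forall>h. 0 < h \<and> h < d \<longrightarrow>
        norm (integral (cbox x (x + h *\<^sub>R One)) f /\<^sub>R h ^ DIM('a) - f x) < e"
    using integrable_ccontinuous_explicit int set_lebesgue_integral_eq_integral(1) by metis
  have "f x = 0" if x: "x \<notin> N" for x
  proof (rule ccontr)
    assume "f x \<noteq> 0"
    then obtain d :: real where "0 < d" "\<forall>h. 0 < h \<and> h < d \<longrightarrow> norm (- f x) < \<bar>f x\<bar>"
      using N(2)[OF x, of "\<bar>f x\<bar>"] unfolding zero by auto
    from this(2)[rule_format, of "d / 2"] this(1) show False by simp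
  qed
  moreover have "AE x in lebesgue. x \<notin> N"
    using N(1) by (intro AE_not_in) (simp add: negligible_iff_null_sets)
  ultimately show ?thesis by auto
qed

text \<open>
  Testing with bumps that converge boundedly to the indicator function of a box in \<open>U\<close> shows
  that \<open>g\<close> has integral \<open>0\<close> over each such box, and \<open>U\<close> is a countable union of boxes.
\<close>

lemma fundamental_lemma_calculus_of_variations:
  fixes g :: "'a::euclidean_space \<Rightarrow> real"
  assumes "open U" and g: "locally_integrable U g"
    and zero: "\<And>\<phi>. \<phi> \<in> test_functions U \<Longrightarrow> (LINT x|lebesgue_on U. g x * \<phi> x) = 0"
  shows "AE x in lebesgue_on U. g x = 0"
proof -
  have Umeas: "U \<in> sets lebesgue" using \<open>open U\<close> by auto
  have box0: "(LINT x:cbox a b|lebesgue. g x) = 0" if "cbox a b \<subseteq> U" for a b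
  proof -
    have int: "integrable lebesgue (\<lambda>x. indicator (cbox a b) x * g x)"
      using g that unfolding locally_integrable_def set_integrable_def by auto
    have meas: "(\<lambda>x. indicat_real (cbox a b) x * g x * indicat_real (box a b) x) \<in> borel_measurable lebesgue"
      by (rule borel_measurable_times)
         (use int in \<open>auto intro!: borel_measurable_indicator simp del: borel_measurable_indicator_iff\<close>)
    have "(LINT x|lebesgue. (indicator (cbox a b) x * g x) * box_bump a b k x) = 0" for k
    proof -
      have "(LINT x|lebesgue_on U. g x * box_bump a b k x) =
            (LINT x|lebesgue. indicator U x * (g x * box_bump a b k x))"
        by (subst integral_restrict_space) (use Umeas in auto)
      also have "\<dots> = (LINT x|lebesgue. (indicator (cbox a b) x * g x) * box_bump a b k x)"
        using that box_bump_eq_0[of _ a b k] box_subset_cbox[of a b]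
        by (intro Bochner_Integration.integral_cong) (auto simp: indicator_def)
      finally show ?thesis
        using zero[OF box_bump_test_function[OF that]] by simp
    qed
    moreover have "(\<lambda>k. LINT x|lebesgue. (indicator (cbox a b) x * g x) * box_bump a b k x)
        \<longlonglongrightarrow> (LINT x|lebesgue. (indicator (cbox a b) x * g x) * indicator (box a b) x)"
    proof (rule integral_dominated_convergence[where w = "\<lambda>x. \<bar>indicator (cbox a b) x * g x\<bar>"])
      show "(\<lambda>x. indicat_real (cbox a b) x * g x * box_bump a b k x) \<in> borel_measurable lebesgue" for k
      proof (rule borel_measurable_times)
        show "box_bump a b k \<in> borel_measurable lebesgue"
          by (intro measurable_completion) (simp add: borel_measurable_continuous_onI continuous_on_box_bump)
      qed (use int in auto)
      show "AE x in lebesgue. norm (indicat_real (cbox a b) x * g x * box_bump a b k x)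
              \<le> \<bar>indicat_real (cbox a b) x * g x\<bar>" for k
        by (auto simp: abs_mult box_bump_nonneg box_bump_le_1 intro!: AE_I2 mult_right_le_one_le)
    qed (use int meas in \<open>auto intro!: AE_I2 tendsto_mult tendsto_const box_bump_tendsto\<close>)
    ultimately have "(LINT x|lebesgue. (indicator (cbox a b) x * g x) * indicator (box a b) x) = 0"
      by (simp add: LIMSEQ_const_iff)
    moreover have "(LINT x|lebesgue. (indicator (cbox a b) x * g x) * indicator (box a b) x)
        = (LINT x|lebesgue. indicator (cbox a b) x * g x)"
    proof (rule integral_cong_AE)
      have "AE x in lebesgue. x \<notin> cbox a b - box a b"
        using negligible_frontier_interval[of a b] by (intro AE_not_in) (simp add: negligible_iff_null_sets)
      then show "AE x in lebesgue. indicat_real (cbox a b) x * g x * indicat_real (box a b) x = indicat_real (cbox a b) x * g x"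
        by eventually_elim (auto simp: indicator_def)
    qed (use int meas in auto)
    ultimately show ?thesis by (simp add: set_lebesgue_integral_def)
  qed
  obtain \<D> where \<D>: "countable \<D>" "\<And>X. X \<in> \<D> \<Longrightarrow> \<exists>a b. X = cbox a b" "\<Union>\<D> = U"
    using open_countable_Union_open_cbox[OF \<open>open U\<close>] by metis
  have "AE x in lebesgue. x \<in> X \<longrightarrow> g x = 0" if "X \<in> \<D>" for X
  proof -
    from \<D>(2)[OF that] obtain c d where X: "X = cbox c d" by auto
    then have sub: "cbox c d \<subseteq> U" using \<D>(3) that by auto
    let ?f = "\<lambda>x. indicator (cbox c d) x * g x"
    have "AE x in lebesgue. ?f x = 0"
    proof (rule AE_zero_if_box_integrals_zero)
      show "integrable lebesgue ?f"
        using g sub unfolding locally_integrable_def set_integrable_def by auto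
      show "(LINT x:cbox a b|lebesgue. ?f x) = 0" for a b
      proof -
        obtain a' b' where ab: "cbox a b \<inter> cbox c d = cbox a' b'"
          using Int_interval[of a b c d] by blast
        then have "(LINT x:cbox a b|lebesgue. ?f x) = (LINT x:cbox a' b'|lebesgue. g x)"
          unfolding set_lebesgue_integral_def ab[symmetric]
          by (intro Bochner_Integration.integral_cong) (auto simp: indicator_def)
        also have "\<dots> = 0" using ab sub by (intro box0) blast
        finally show ?thesis .
      qed
    qed
    then show ?thesis by eventually_elim (auto simp: X)
  qed
  then have "AE x in lebesgue. \<forall>X\<in>\<D>. x \<in> X \<longrightarrow> g x = 0"
    using \<D>(1) by (subst AE_ball_countable) auto
  then show ?thesis
    using \<D>(3) Umeas by (subst AE_restrict_space_iff) auto
qed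

section \<open>Integration by parts and uniqueness of weak gradients\<close>

text \<open>
  Translation invariance makes the integral of every difference quotient in direction \<open>v\<close>
  vanish. The quotients converge to the directional derivative, dominated through the mean value
  theorem by its maximum on a bounded set.
\<close>

lemma integral_directional_derivative_zero:
  fixes \<psi> :: "'a::euclidean_space \<Rightarrow> real"
  assumes D: "\<And>x. (\<psi> has_derivative \<psi>' x) (at x)"
    and cont: "continuous_on UNIV (\<lambda>x. \<psi>' x v)"
    and K: "compact K" "\<And>x. x \<notin> K \<Longrightarrow> \<psi> x = 0"
  shows "(LINT x|lborel. \<psi>' x v) = 0"
proof -
  have along: "((\<lambda>t. \<psi> (t *\<^sub>R v + x)) has_derivative (\<lambda>s. \<psi>' (t *\<^sub>R v + x) (s *\<^sub>R v))) (at t)" for x t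
  proof -
    have "((\<lambda>t. t *\<^sub>R v + x) has_derivative (\<lambda>s. s *\<^sub>R v)) (at t)"
      by (auto intro!: derivative_eq_intros)
    from has_derivative_compose[OF this D] show ?thesis .
  qed
  have D0: "\<psi>' x = (\<lambda>_. 0)" if "x \<notin> K" for x
  proof -
    have "((\<lambda>_. 0) has_derivative \<psi>' x) (at x)"
      by (rule has_derivative_transform_within_open[OF D, where s = "- K"])
         (use that K in \<open>auto intro: compact_imp_closed\<close>)
    then show ?thesis
      using has_derivative_unique has_derivative_const by blast
  qed
  have c\<psi>: "continuous_on UNIV \<psi>"
    using D by (meson continuous_at_imp_continuous_on has_derivative_continuous)
  have [measurable]: "\<psi> \<in> borel_measurable borel" "(\<lambda>x. \<psi>' x v) \<in> borel_measurable borel"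
    using c\<psi> cont by (auto intro: borel_measurable_continuous_onI)
  obtain M where M: "\<And>x. \<bar>\<psi>' x v\<bar> \<le> M"
  proof -
    have "bounded ((\<lambda>x. \<psi>' x v) ` K)"
      using K(1) cont by (meson compact_continuous_image compact_imp_bounded continuous_on_subset subset_UNIV)
    then obtain M where "\<And>x. x \<in> K \<Longrightarrow> \<bar>\<psi>' x v\<bar> \<le> M"
      by (auto simp: bounded_iff)
    then have "\<bar>\<psi>' x v\<bar> \<le> max M 0" for x
      using D0[of x] by (cases "x \<in> K") (auto simp: le_max_iff_disj)
    then show ?thesis using that by blast
  qed
  obtain R where R: "\<And>x. x \<in> K \<Longrightarrow> norm x \<le> R"
    using compact_imp_bounded[OF K(1)] by (auto simp: bounded_iff)
  have intpsi: "integrable lborel \<psi>"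
  proof -
    have "integrable lborel (\<lambda>x. indicator K x *\<^sub>R \<psi> x)"
      using K(1) c\<psi> by (intro borel_integrable_compact) (auto intro: continuous_on_subset)
    moreover have "(\<lambda>x. indicator K x *\<^sub>R \<psi> x) = \<psi>"
      using K(2) by (force simp: indicator_def)
    ultimately show ?thesis by simp
  qed
  define h where "h n = inverse (real (Suc n))" for n
  have h: "0 < h n" "h n \<le> 1" for n
    by (auto simp: h_def inverse_le_1_iff)
  define q where "q n x = (\<psi> (h n *\<^sub>R v + x) - \<psi> x) / h n" for n x
  have "(LINT x|lborel. q n x) = 0" for n
  proof -
    have "integrable lborel (\<lambda>x. \<psi> (h n *\<^sub>R v + x))" and
      "(LINT x|lborel. \<psi> (h n *\<^sub>R v + x)) = (LINT x|lborel. \<psi> x)"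
    proof -
      have "integrable (distr lborel borel ((+) (h n *\<^sub>R v))) \<psi>"
        using intpsi by (simp add: lborel_distr_plus)
      then show "integrable lborel (\<lambda>x. \<psi> (h n *\<^sub>R v + x))"
        by (subst (asm) integrable_distr_eq) auto
      have "integral\<^sup>L (distr lborel borel ((+) (h n *\<^sub>R v))) \<psi> = (LINT x|lborel. \<psi> (h n *\<^sub>R v + x))"
        by (subst integral_distr) auto
      then show "(LINT x|lborel. \<psi> (h n *\<^sub>R v + x)) = (LINT x|lborel. \<psi> x)"
        by (simp add: lborel_distr_plus)
    qed
    then show ?thesis
      using intpsi by (simp add: q_def)
  qed
  moreover have "(\<lambda>n. LINT x|lborel. q n x) \<longlonglongrightarrow> (LINT x|lborel. \<psi>' x v)"
  proof (rule integral_dominated_convergence[where w = "\<lambda>x. M * indicator (cball 0 (R + norm v)) x"])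
    show "integrable lborel (\<lambda>x. M * indicat_real (cball 0 (R + norm v)) x)"
      by (intro integrable_mult_right integrable_real_indicator) (use emeasure_lborel_cball_finite[of 0 "R + norm v"] in \<open>auto simp: top.not_eq_extremum\<close>)
    show "AE x in lborel. (\<lambda>n. q n x) \<longlonglongrightarrow> \<psi>' x v"
    proof (rule AE_I2)
      fix x
      have "((\<lambda>t. \<psi> (t *\<^sub>R v + x)) has_derivative (\<lambda>t. \<psi>' x (t *\<^sub>R v))) (at 0)"
        using along[of x 0] by simp
      moreover have "\<psi>' x (t *\<^sub>R v) = \<psi>' x v * t" for t
        using has_derivative_linear[OF D[of x]] by (simp add: linear_cmul)
      ultimately have "((\<lambda>t. \<psi> (t *\<^sub>R v + x)) has_real_derivative \<psi>' x v) (at 0)"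
        by (simp add: has_field_derivative_def)
      then have "((\<lambda>t. (\<psi> (t *\<^sub>R v + x) - \<psi> x) / t) \<longlongrightarrow> \<psi>' x v) (at 0)"
        by (simp add: has_field_derivative_iff)
      moreover have "filterlim h (at 0) sequentially"
        unfolding filterlim_at using h(1) LIMSEQ_inverse_real_of_nat
        by (auto simp: h_def[abs_def])
      ultimately show "(\<lambda>n. q n x) \<longlonglongrightarrow> \<psi>' x v"
        unfolding q_def by (rule filterlim_compose)
    qed
    show "AE x in lborel. norm (q n x) \<le> M * indicat_real (cball 0 (R + norm v)) x" for n
    proof (rule AE_I2)
      fix x
      have "\<exists>t. 0 < t \<and> t < h n \<and> \<psi> (h n *\<^sub>R v + x) - \<psi> (0 *\<^sub>R v + x) = \<psi>' (t *\<^sub>R v + x) ((h n - 0) *\<^sub>R v)"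
      proof -
        obtain t where "t \<in> {0<..<h n}" "\<psi> (h n *\<^sub>R v + x) - \<psi> (0 *\<^sub>R v + x) = \<psi>' (t *\<^sub>R v + x) ((h n - 0) *\<^sub>R v)"
          using mvt_simple[of 0 "h n" "\<lambda>t. \<psi> (t *\<^sub>R v + x)" "\<lambda>t s. \<psi>' (t *\<^sub>R v + x) (s *\<^sub>R v)"]
            h(1)[of n] along has_derivative_at_withinI by blast
        then show ?thesis by auto
      qed
      then obtain t where "\<psi> (h n *\<^sub>R v + x) - \<psi> x = \<psi>' (t *\<^sub>R v + x) (h n *\<^sub>R v)" by auto
      also have "\<dots> = h n * \<psi>' (t *\<^sub>R v + x) v"
        using has_derivative_linear[OF D] by (simp add: linear_cmul)
      finally have "q n x = \<psi>' (t *\<^sub>R v + x) v"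
        using h(1)[of n] by (simp add: q_def)
      then have le: "norm (q n x) \<le> M" using M by simp
      show "norm (q n x) \<le> M * indicat_real (cball 0 (R + norm v)) x"
      proof (cases "x \<in> cball 0 (R + norm v)")
        case False
        then have "R + norm v < norm x" by simp
        moreover have "norm (h n *\<^sub>R v) \<le> norm v"
          using h[of n] by (simp add: mult_left_le_one_le)
        moreover have "norm x \<le> norm (h n *\<^sub>R v + x) + norm (h n *\<^sub>R v)"
          by (metis add.commute add_diff_cancel_left' norm_triangle_ineq4 add_diff_cancel_right')
        ultimately have "R < norm (h n *\<^sub>R v + x)" "R < norm x"
          using norm_ge_zero[of v] by linarith+
        then have "\<psi> (h n *\<^sub>R v + x) = 0" "\<psi> x = 0"
          using R K(2) not_less by blast+
        then show ?thesis using False by (simp add: q_def)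
      qed (use le in simp)
    qed
  qed (auto simp: q_def)
  ultimately show ?thesis by (simp add: LIMSEQ_const_iff)
qed

lemma integrable_continuous_compact_support:
  fixes f :: "'a::euclidean_space \<Rightarrow> real"
  assumes "open U" "continuous_on U f" "compact K" "K \<subseteq> U" "\<And>x. x \<in> U - K \<Longrightarrow> f x = 0"
  shows "integrable (lebesgue_on U) f"
proof -
  have "integrable lborel (\<lambda>x. indicator K x *\<^sub>R f x)"
    using assms by (intro borel_integrable_compact) (auto intro: continuous_on_subset)
  then have "integrable lebesgue (\<lambda>x. indicator K x *\<^sub>R f x)"
    using borel_measurable_integrable by (subst integrable_completion) blast+
  moreover have "indicator K x *\<^sub>R f x = indicator U x *\<^sub>R f x" for x
    using assms by (auto simp: indicator_def)
  ultimately show ?thesis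
    using \<open>open U\<close> by (subst integrable_restrict_space) (simp_all only:, simp)
qed

lemma smooth_onD:
  assumes "smooth_on U f"
  shows "\<And>x. x \<in> U \<Longrightarrow> (f has_derivative frechet_derivative f (at x)) (at x)"
    and "continuous_on U f"
    and "\<And>i. i \<in> Basis \<Longrightarrow> continuous_on U (\<lambda>x. frechet_derivative f (at x) i)"
proof -
  have 1: "f differentiable (at x)" if "x \<in> U" for x
    using assms that iter_deriv.simps(1)[of f] unfolding smooth_on_def by (metis lists.Nil)
  then show "\<And>x. x \<in> U \<Longrightarrow> (f has_derivative frechet_derivative f (at x)) (at x)"
    by (simp add: frechet_derivative_works)
  show "continuous_on U f"
    using 1 by (meson continuous_at_imp_continuous_on differentiable_imp_continuous_within)
  fix i :: 'a assume "i \<in> Basis"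
  then have "(\<lambda>x. frechet_derivative f (at x) i) differentiable (at x)" if "x \<in> U" for x
    using assms that unfolding smooth_on_def by (auto dest!: bspec[of _ _ "[i]"])
  then show "continuous_on U (\<lambda>x. frechet_derivative f (at x) i)"
    by (meson continuous_at_imp_continuous_on differentiable_imp_continuous_within)
qed

lemma test_functionsE:
  assumes "\<phi> \<in> test_functions U"
  obtains K where "smooth_on U \<phi>" "compact K" "K \<subseteq> U" "\<And>x. x \<in> U - K \<Longrightarrow> \<phi> x = 0"
  using assms closure_subset[of "{x \<in> U. \<phi> x \<noteq> 0}"] unfolding test_functions_def compact_support_in_def by blast

lemma frechet_derivative_zero_off_support:
  fixes \<phi> :: "'a::euclidean_space \<Rightarrow> real"
  assumes "open U" "compact K" "\<And>x. x \<in> U - K \<Longrightarrow> \<phi> x = 0" "x \<in> U - K"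
  shows "frechet_derivative \<phi> (at x) = (\<lambda>_. 0)"
proof -
  have "open (U - K)" using assms(1,2) by (simp add: compact_imp_closed open_Diff)
  then have "(\<phi> has_derivative (\<lambda>_. 0)) (at x)"
    using assms(3,4)
    by (intro has_derivative_transform_within_open[OF has_derivative_const[of 0]]) auto
  then show ?thesis by (metis frechet_derivative_at)
qed

text \<open>
  Extended by \<open>0\<close> outside \<open>U\<close>, the product \<open>v * \<phi>\<close> is continuously differentiable on the whole
  space, because \<open>U\<close> and the complement of the support of \<open>\<phi>\<close> form an open cover on each of
  which this is clear. So the integral of its partial derivative vanishes.
\<close>

lemma integration_by_parts_test_function:
  assumes "open U" "smooth_on U v" "\<phi> \<in> test_functions U" "i \<in> Basis"
  shows "(LINT x|lebesgue_on U. v x * frechet_derivative \<phi> (at x) i) =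
         - (LINT x|lebesgue_on U. frechet_derivative v (at x) i * \<phi> x)"
proof -
  let ?D\<phi> = "\<lambda>x. frechet_derivative \<phi> (at x)" and ?Dv = "\<lambda>x. frechet_derivative v (at x)"
  obtain K where \<phi>: "smooth_on U \<phi>" and K: "compact K" "K \<subseteq> U" "\<And>x. x \<in> U - K \<Longrightarrow> \<phi> x = 0"
    using test_functionsE[OF assms(3)] by blast
  have D\<phi>0: "?D\<phi> x i = 0" if "x \<in> U - K" for x
    using frechet_derivative_zero_off_support[OF \<open>open U\<close> K(1,3) that] by simp
  define \<psi> where "\<psi> x = (if x \<in> U then v x * \<phi> x else 0)" for x
  define \<psi>' where "\<psi>' x h = (if x \<in> U then v x * ?D\<phi> x h + ?Dv x h * \<phi> x else 0)" for x h
  have int1: "integrable (lebesgue_on U) (\<lambda>x. v x * ?D\<phi> x i)"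
    using assms \<phi> K D\<phi>0
    by (intro integrable_continuous_compact_support[of U _ K] continuous_intros smooth_onD) auto
  have int2: "integrable (lebesgue_on U) (\<lambda>x. ?Dv x i * \<phi> x)"
    using assms \<phi> K
    by (intro integrable_continuous_compact_support[of U _ K] continuous_intros smooth_onD) auto
  have openK: "open (- K)" using K(1) by (simp add: compact_imp_closed open_Compl)
  have cont: "continuous_on UNIV (\<lambda>x. \<psi>' x i)"
  proof -
    have "continuous_on U (\<lambda>x. \<psi>' x i)"
      using assms \<phi> by (subst continuous_on_cong[OF refl, of _ _ "\<lambda>x. v x * ?D\<phi> x i + ?Dv x i * \<phi> x"])
        (auto simp: \<psi>'_def intro!: continuous_intros smooth_onD(2,3)[OF assms(2)] smooth_onD(2,3)[OF \<phi>])
    moreover have "continuous_on (- K) (\<lambda>x. \<psi>' x i)"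
      using K D\<phi>0 by (subst continuous_on_cong[OF refl, of _ _ "\<lambda>x. 0"]) (auto simp: \<psi>'_def)
    ultimately have "continuous_on (U \<union> - K) (\<lambda>x. \<psi>' x i)"
      using \<open>open U\<close> openK by (rule continuous_on_open_Un[rotated 2])
    moreover have "U \<union> - K = UNIV" using K(2) by auto
    ultimately show ?thesis by simp
  qed
  have "(\<psi> has_derivative \<psi>' x) (at x)" for x
  proof (cases "x \<in> U")
    case True
    have "((\<lambda>x. v x * \<phi> x) has_derivative \<psi>' x) (at x)"
      using has_derivative_mult[OF smooth_onD(1)[OF assms(2) True] smooth_onD(1)[OF \<phi> True]] True
      by (simp add: \<psi>'_def[abs_def])
    then show ?thesis
      by (rule has_derivative_transform_within_open[OF _ \<open>open U\<close> True]) (simp add: \<psi>_def)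
  next
    case False
    have "((\<lambda>x. 0) has_derivative \<psi>' x) (at x)"
      using False by (simp add: \<psi>'_def[abs_def])
    then show ?thesis
      by (rule has_derivative_transform_within_open[OF _ openK]) (use False K in \<open>auto simp: \<psi>_def\<close>)
  qed
  then have "(LINT x|lborel. \<psi>' x i) = 0"
    by (rule integral_directional_derivative_zero[where \<psi>' = \<psi>' and \<psi> = \<psi>, OF _ cont K(1)]) (use K in \<open>auto simp: \<psi>_def\<close>)
  also have "(LINT x|lborel. \<psi>' x i) = (LINT x|lebesgue. \<psi>' x i)"
    using cont by (subst integral_completion) (auto intro: borel_measurable_continuous_onI)
  also have "\<dots> = (LINT x|lebesgue_on U. v x * ?D\<phi> x i + ?Dv x i * \<phi> x)"
    using \<open>open U\<close> by (subst integral_restrict_space) (auto simp: \<psi>'_def indicator_def intro!: Bochner_Integration.integral_cong)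
  finally show ?thesis using int1 int2 by simp
qed

lemma integrable_locally_integrable_test_function:
  fixes g :: "'a::euclidean_space \<Rightarrow> real"
  assumes "open U" "locally_integrable U g" "\<phi> \<in> test_functions U"
  shows "integrable (lebesgue_on U) (\<lambda>x. g x * \<phi> x)"
proof -
  obtain K where \<phi>: "smooth_on U \<phi>" and K: "compact K" "K \<subseteq> U" "\<And>x. x \<in> U - K \<Longrightarrow> \<phi> x = 0"
    using test_functionsE[OF assms(3)] by blast
  have cK: "continuous_on K \<phi>"
    using smooth_onD(2)[OF \<phi>] K(2) continuous_on_subset by blast
  have "(\<lambda>x. \<phi> x * g x) absolutely_integrable_on K"
  proof (rule absolutely_integrable_bounded_measurable_product[OF bilinear_times])
    show "\<phi> \<in> borel_measurable (lebesgue_on K)"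
      using cK K(1) by (simp add: continuous_imp_measurable_on_sets_lebesgue lmeasurable_compact fmeasurableD)
    show "bounded (\<phi> ` K)"
      using cK K(1) by (simp add: compact_continuous_image compact_imp_bounded)
  qed (use assms K in \<open>auto simp: locally_integrable_def lmeasurable_compact fmeasurableD\<close>)
  moreover have "indicator K x *\<^sub>R (\<phi> x * g x) = indicator U x *\<^sub>R (g x * \<phi> x)" for x
    using K by (auto simp: indicator_def)
  ultimately show ?thesis
    using \<open>open U\<close> unfolding set_integrable_def by (subst integrable_restrict_space) (simp_all only:, simp)
qed

lemma locally_integrable_continuous:
  fixes f :: "'a::euclidean_space \<Rightarrow> 'b::euclidean_space"
  assumes "continuous_on U f" shows "locally_integrable U f"
  unfolding locally_integrable_def set_integrable_def
proof safe
  fix K :: "'a set" assume "compact K" "K \<subseteq> U"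
  then have "integrable lborel (\<lambda>x. indicator K x *\<^sub>R f x)"
    using assms by (intro borel_integrable_compact) (auto intro: continuous_on_subset)
  then show "integrable lebesgue (\<lambda>x. indicator K x *\<^sub>R f x)"
    using borel_measurable_integrable by (subst integrable_completion) blast+
qed

lemma locally_integrable_diff:
  "locally_integrable U f \<Longrightarrow> locally_integrable U g \<Longrightarrow> locally_integrable U (\<lambda>x. f x - g x)"
  by (auto simp: locally_integrable_def intro: set_integral_diff)

lemma locally_integrable_inner:
  "locally_integrable U f \<Longrightarrow> locally_integrable U (\<lambda>x. f x \<bullet> c)"
  unfolding locally_integrable_def set_integrable_def
  by (auto simp: inner_scaleR_left[symmetric] simp del: inner_scaleR_left intro!: integrable_inner_left)

lemma weak_partial_unique:
  fixes f g :: "'a::euclidean_space \<Rightarrow> real"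
  assumes "open U" "locally_integrable U f" "locally_integrable U g"
    and eq: "\<And>\<phi>. \<phi> \<in> test_functions U \<Longrightarrow>
      (LINT x|lebesgue_on U. f x * \<phi> x) = (LINT x|lebesgue_on U. g x * \<phi> x)"
  shows "AE x in lebesgue_on U. f x = g x"
proof -
  have "AE x in lebesgue_on U. f x - g x = 0"
  proof (rule fundamental_lemma_calculus_of_variations)
    fix \<phi> :: "'a \<Rightarrow> real" assume "\<phi> \<in> test_functions U"
    then show "(LINT x|lebesgue_on U. (f x - g x) * \<phi> x) = 0"
      using eq integrable_locally_integrable_test_function[OF assms(1,2)]
        integrable_locally_integrable_test_function[OF assms(1,3)]
      by (simp add: left_diff_distrib)
  qed (use assms in \<open>auto intro: locally_integrable_diff\<close>)
  then show ?thesis by simp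
qed

lemma has_weak_gradientD:
  assumes "has_weak_gradient U u g"
  shows "locally_integrable U u" and "locally_integrable U g"
    and "\<And>\<phi> i. \<phi> \<in> test_functions U \<Longrightarrow> i \<in> Basis \<Longrightarrow>
      (LINT x|lebesgue_on U. u x * frechet_derivative \<phi> (at x) i) =
      - (LINT x|lebesgue_on U. (g x \<bullet> i) * \<phi> x)"
  using assms unfolding has_weak_gradient_def by blast+

lemma weak_gradient_unique:
  assumes "open U" "has_weak_gradient U u g" "has_weak_gradient U u h"
  shows "AE x in lebesgue_on U. g x = h x"
proof -
  have "AE x in lebesgue_on U. g x \<bullet> i = h x \<bullet> i" if "i \<in> Basis" for i
  proof (rule weak_partial_unique)
    fix \<phi> :: "'a \<Rightarrow> real" assume "\<phi> \<in> test_functions U"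
    from has_weak_gradientD(3)[OF assms(2) this that] has_weak_gradientD(3)[OF assms(3) this that]
    show "(LINT x|lebesgue_on U. (g x \<bullet> i) * \<phi> x) = (LINT x|lebesgue_on U. (h x \<bullet> i) * \<phi> x)"
      by simp
  qed (use assms in \<open>auto simp: has_weak_gradient_def intro: locally_integrable_inner\<close>)
  then have "AE x in lebesgue_on U. \<forall>i\<in>Basis. g x \<bullet> i = h x \<bullet> i"
    by (simp add: AE_finite_all)
  then show ?thesis
    by (rule AE_mp) (auto intro: euclidean_eqI)
qed

lemma weak_gradient_smooth:
  assumes "open U" "smooth_on U v" "has_weak_gradient U v g" "i \<in> Basis"
  shows "AE x in lebesgue_on U. g x \<bullet> i = frechet_derivative v (at x) i"
proof (rule weak_partial_unique)
  fix \<phi> :: "'a \<Rightarrow> real" assume "\<phi> \<in> test_functions U"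
  from has_weak_gradientD(3)[OF assms(3) this assms(4)]
    integration_by_parts_test_function[OF assms(1,2) this assms(4)]
  show "(LINT x|lebesgue_on U. (g x \<bullet> i) * \<phi> x) =
    (LINT x|lebesgue_on U. frechet_derivative v (at x) i * \<phi> x)" by simp
qed (use assms in \<open>auto simp: has_weak_gradient_def
      intro: locally_integrable_inner locally_integrable_continuous smooth_onD\<close>)

section \<open>Weighted Lebesgue and Sobolev spaces as linear spaces\<close>

text \<open>
  A scaled quasi-triangle inequality for \<open>p\<close>-th powers. It stands in for the inequality of
  Minkowski below.
\<close>

lemma powr_sum_le:
  fixes s x y a b p :: real
  assumes "0 \<le> p" "\<bar>s\<bar> \<le> \<bar>a\<bar> * \<bar>x\<bar> + \<bar>b\<bar> * \<bar>y\<bar>"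
  shows "\<bar>s\<bar> powr p \<le> 2 powr p * (\<bar>a\<bar> powr p * \<bar>x\<bar> powr p + \<bar>b\<bar> powr p * \<bar>y\<bar> powr p)"
proof -
  let ?m = "max (\<bar>a\<bar> * \<bar>x\<bar>) (\<bar>b\<bar> * \<bar>y\<bar>)"
  have "\<bar>s\<bar> powr p \<le> (2 * ?m) powr p"
    using assms by (intro powr_mono2) (auto simp: max_def)
  also have "\<dots> = 2 powr p * ?m powr p"
    by (intro powr_mult)
  also have "?m powr p \<le> (\<bar>a\<bar> * \<bar>x\<bar>) powr p + (\<bar>b\<bar> * \<bar>y\<bar>) powr p"
    by (auto simp: max_def)
  finally show ?thesis by (simp add: powr_mult)
qed

text \<open>
  Domination rather than equality in the last hypothesis lets the same lemma treat linear
  combinations of functions and the norms of linear combinations of gradients.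
\<close>

lemma Lp_dominated_combination:
  fixes f :: "'a::euclidean_space \<Rightarrow> real"
  assumes "open U" "0 \<le> p" and \<rho>: "\<rho> \<in> borel_measurable (lebesgue_on U)" "AE x in lebesgue_on U. 0 \<le> \<rho> x"
    and u: "u \<in> Lp U p \<rho>" and v: "v \<in> Lp U p \<rho>" and f: "f \<in> borel_measurable (lebesgue_on U)"
    and le: "\<And>x. \<bar>f x\<bar> \<le> \<bar>a\<bar> * \<bar>u x\<bar> + \<bar>b\<bar> * \<bar>v x\<bar>"
  shows "f \<in> Lp U p \<rho>"
    and "(LINT x|lebesgue_on U. \<bar>f x\<bar> powr p * \<rho> x) \<le>
      2 powr p * (\<bar>a\<bar> powr p * (LINT x|lebesgue_on U. \<bar>u x\<bar> powr p * \<rho> x)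
                + \<bar>b\<bar> powr p * (LINT x|lebesgue_on U. \<bar>v x\<bar> powr p * \<rho> x))"
proof -
  let ?M = "lebesgue_on U"
  let ?R = "\<lambda>x. 2 powr p * (\<bar>a\<bar> powr p * (\<bar>u x\<bar> powr p * \<rho> x) + \<bar>b\<bar> powr p * (\<bar>v x\<bar> powr p * \<rho> x))"
  have iu: "integrable ?M (\<lambda>x. \<bar>u x\<bar> powr p * \<rho> x)" and iv: "integrable ?M (\<lambda>x. \<bar>v x\<bar> powr p * \<rho> x)"
    using u v by (auto simp: Lp_def)
  then have iR: "integrable ?M ?R" by simp
  have AEle: "AE x in ?M. 0 \<le> \<bar>f x\<bar> powr p * \<rho> x \<and> \<bar>f x\<bar> powr p * \<rho> x \<le> ?R x"
    using \<rho>(2)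
  proof eventually_elim
    case (elim x)
    have "\<bar>f x\<bar> powr p * \<rho> x \<le> (2 powr p * (\<bar>a\<bar> powr p * \<bar>u x\<bar> powr p + \<bar>b\<bar> powr p * \<bar>v x\<bar> powr p)) * \<rho> x"
      using powr_sum_le[OF assms(2) le] elim by (rule mult_right_mono)
    then show ?case using elim by (simp add: algebra_simps)
  qed
  have meas: "(\<lambda>x. \<bar>f x\<bar> powr p * \<rho> x) \<in> borel_measurable ?M"
    using f \<rho>(1) by measurable
  have fi: "integrable ?M (\<lambda>x. \<bar>f x\<bar> powr p * \<rho> x)"
    by (rule Bochner_Integration.integrable_bound[OF iR meas]) (use AEle in eventually_elim, force)
  then show "f \<in> Lp U p \<rho>" using f by (simp add: Lp_def)
  have "(LINT x|?M. \<bar>f x\<bar> powr p * \<rho> x) \<le> (LINT x|?M. ?R x)"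
    by (rule integral_mono_AE[OF fi iR]) (use AEle in eventually_elim, simp)
  also have "\<dots> = 2 powr p * (\<bar>a\<bar> powr p * (LINT x|?M. \<bar>u x\<bar> powr p * \<rho> x)
                + \<bar>b\<bar> powr p * (LINT x|?M. \<bar>v x\<bar> powr p * \<rho> x))"
    using iu iv by simp
  finally show "(LINT x|?M. \<bar>f x\<bar> powr p * \<rho> x) \<le>
      2 powr p * (\<bar>a\<bar> powr p * (LINT x|?M. \<bar>u x\<bar> powr p * \<rho> x)
                + \<bar>b\<bar> powr p * (LINT x|?M. \<bar>v x\<bar> powr p * \<rho> x))" .
qed

lemma Lp_combination:
  fixes u v :: "'a::euclidean_space \<Rightarrow> real"
  assumes "open U" "0 \<le> p" "\<rho> \<in> borel_measurable (lebesgue_on U)" "AE x in lebesgue_on U. 0 \<le> \<rho> x"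
    "u \<in> Lp U p \<rho>" "v \<in> Lp U p \<rho>"
  shows "(\<lambda>x. a * u x + b * v x) \<in> Lp U p \<rho>"
    and "(LINT x|lebesgue_on U. \<bar>a * u x + b * v x\<bar> powr p * \<rho> x) \<le>
      2 powr p * (\<bar>a\<bar> powr p * (LINT x|lebesgue_on U. \<bar>u x\<bar> powr p * \<rho> x)
                + \<bar>b\<bar> powr p * (LINT x|lebesgue_on U. \<bar>v x\<bar> powr p * \<rho> x))"
proof -
  have m: "(\<lambda>x. a * u x + b * v x) \<in> borel_measurable (lebesgue_on U)"
    using assms(5,6) by (auto simp: Lp_def)
  have le: "\<bar>a * u x + b * v x\<bar> \<le> \<bar>a\<bar> * \<bar>u x\<bar> + \<bar>b\<bar> * \<bar>v x\<bar>" for x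
    by (metis abs_mult abs_triangle_ineq)
  show "(\<lambda>x. a * u x + b * v x) \<in> Lp U p \<rho>"
    by (rule Lp_dominated_combination[OF assms m le])
  show "(LINT x|lebesgue_on U. \<bar>a * u x + b * v x\<bar> powr p * \<rho> x) \<le>
      2 powr p * (\<bar>a\<bar> powr p * (LINT x|lebesgue_on U. \<bar>u x\<bar> powr p * \<rho> x)
                + \<bar>b\<bar> powr p * (LINT x|lebesgue_on U. \<bar>v x\<bar> powr p * \<rho> x))"
    by (rule Lp_dominated_combination[OF assms m le])
qed

text \<open>
  The function is the pointwise limit of its restrictions to an exhaustion of \<open>U\<close> by compact
  sets.
\<close>

lemma locally_integrable_measurable:
  fixes f :: "'a::euclidean_space \<Rightarrow> 'b::euclidean_space"
  assumes "open U" "locally_integrable U f"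
  shows "f \<in> borel_measurable (lebesgue_on U)"
proof (rule open_Union_compact_subsets[OF assms(1)])
  fix C :: "nat \<Rightarrow> 'a set"
  assume C: "\<And>n. compact (C n)" "\<And>n. C n \<subseteq> U"
    and exhaust: "\<And>K. compact K \<Longrightarrow> K \<subseteq> U \<Longrightarrow> \<exists>N. \<forall>n\<ge>N. K \<subseteq> C n"
  have "(\<lambda>x. indicator U x *\<^sub>R f x) \<in> borel_measurable lebesgue"
  proof (rule borel_measurable_LIMSEQ_metric)
    show "(\<lambda>x. indicator (C n) x *\<^sub>R f x) \<in> borel_measurable lebesgue" for n
      using assms(2) C(1,2) unfolding locally_integrable_def set_integrable_def
      by (blast intro: borel_measurable_integrable)
    show "(\<lambda>n. indicator (C n) x *\<^sub>R f x) \<longlonglongrightarrow> indicator U x *\<^sub>R f x" for x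
    proof (cases "x \<in> U")
      case True
      then obtain N where "\<forall>n\<ge>N. {x} \<subseteq> C n" using exhaust[of "{x}"] by auto
      then have "\<forall>\<^sub>F n in sequentially. indicator U x *\<^sub>R f x = indicator (C n) x *\<^sub>R f x"
        unfolding eventually_sequentially using True by (intro exI[of _ N]) auto
      then show ?thesis by (rule Lim_transform_eventually[OF tendsto_const])
    next
      case False
      then have "x \<notin> C n" for n using C(2) by blast
      then show ?thesis using False by simp
    qed
  qed
  then show ?thesis
    using assms(1) by (subst borel_measurable_restrict_space_iff) (auto simp: ac_simps)
qed

lemma locally_integrable_combination:
  "locally_integrable U f \<Longrightarrow> locally_integrable U g \<Longrightarrow> locally_integrable U (\<lambda>x. a *\<^sub>R f x + b *\<^sub>R g x)"
  by (auto simp: locally_integrable_def intro!: set_integral_add set_integrable_scaleR_right)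

lemma iter_deriv_append: "iter_deriv (is @ js) f = iter_deriv is (iter_deriv js f)"
  by (induction "is") auto

text \<open>
  Partial derivatives of test functions are needed as test functions themselves: they make
  \<open>u * D \<phi>\<close> integrable, so that the integrals defining a weak gradient are additive in \<open>u\<close>.
\<close>

lemma test_functions_partial:
  assumes "\<phi> \<in> test_functions U" "open U" "i \<in> Basis"
  shows "(\<lambda>x. frechet_derivative \<phi> (at x) i) \<in> test_functions U" (is "?D \<in> _")
proof -
  obtain K where \<phi>: "smooth_on U \<phi>" and K: "compact K" "K \<subseteq> U" "\<And>x. x \<in> U - K \<Longrightarrow> \<phi> x = 0"
    using test_functionsE[OF assms(1)] by blast
  have "?D x = 0" if "x \<in> U - K" for x
    using frechet_derivative_zero_off_support[OF \<open>open U\<close> K(1,3) that] by simp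
  then have "closure {x \<in> U. ?D x \<noteq> 0} \<subseteq> K"
    using K(1) by (intro closure_minimal) (auto simp: compact_imp_closed)
  moreover from this have "compact (closure {x \<in> U. ?D x \<noteq> 0})"
    using K(1) by (meson closed_closure compact_imp_bounded bounded_subset compact_eq_bounded_closed)
  moreover have "smooth_on U ?D"
    unfolding smooth_on_def
  proof (intro ballI)
    fix "is" x assume "is \<in> lists (Basis::'a set)" "x \<in> U"
    then have "iter_deriv (is @ [i]) \<phi> differentiable at x"
      using \<phi> assms(3) unfolding smooth_on_def by (metis append_in_lists_conv lists.intros)
    then show "iter_deriv is ?D differentiable at x" by (simp add: iter_deriv_append)
  qed
  ultimately show ?thesis
    using K(2) unfolding test_functions_def compact_support_in_def by auto
qed

lemma has_weak_gradient_combination: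
  assumes "open U" and u: "has_weak_gradient U u g" and v: "has_weak_gradient U v h"
  shows "has_weak_gradient U (\<lambda>x. a * u x + b * v x) (\<lambda>x. a *\<^sub>R g x + b *\<^sub>R h x)"
  unfolding has_weak_gradient_def
proof (intro conjI ballI)
  note li = has_weak_gradientD(1,2)[OF u] has_weak_gradientD(1,2)[OF v]
  show "locally_integrable U (\<lambda>x. a * u x + b * v x)"
    using locally_integrable_combination[OF li(1,3), of a b] by simp
  show "locally_integrable U (\<lambda>x. a *\<^sub>R g x + b *\<^sub>R h x)"
    using locally_integrable_combination[OF li(2,4)] .
  fix \<phi> :: "'a \<Rightarrow> real" and i :: 'a assume \<phi>: "\<phi> \<in> test_functions U" and i: "i \<in> Basis"
  note int = integrable_locally_integrable_test_function[OF \<open>open U\<close>]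
  note int1 = int[OF li(1) test_functions_partial[OF \<phi> \<open>open U\<close> i]]
    int[OF li(3) test_functions_partial[OF \<phi> \<open>open U\<close> i]]
    int[OF locally_integrable_inner[OF li(2)] \<phi>, of i] int[OF locally_integrable_inner[OF li(4)] \<phi>, of i]
  let ?D = "\<lambda>x. frechet_derivative \<phi> (at x) i"
  have "(LINT x|lebesgue_on U. (a * u x + b * v x) * ?D x) =
    a * (LINT x|lebesgue_on U. u x * ?D x) + b * (LINT x|lebesgue_on U. v x * ?D x)"
    using int1 by (simp add: distrib_right mult.assoc)
  also have "\<dots> = - (a * (LINT x|lebesgue_on U. (g x \<bullet> i) * \<phi> x) + b * (LINT x|lebesgue_on U. (h x \<bullet> i) * \<phi> x))"
    using has_weak_gradientD(3)[OF u \<phi> i] has_weak_gradientD(3)[OF v \<phi> i] by simp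
  also have "\<dots> = - (LINT x|lebesgue_on U. ((a *\<^sub>R g x + b *\<^sub>R h x) \<bullet> i) * \<phi> x)"
    using int1 by (simp add: inner_add_left distrib_right mult.assoc)
  finally show "(LINT x|lebesgue_on U. (a * u x + b * v x) * ?D x) =
    - (LINT x|lebesgue_on U. ((a *\<^sub>R g x + b *\<^sub>R h x) \<bullet> i) * \<phi> x)" .
qed

text \<open>
  The \<open>p\<close>-th power of the Sobolev norm.
\<close>

definition energy :: "'a::euclidean_space set \<Rightarrow> real \<Rightarrow> ('a \<Rightarrow> real) \<Rightarrow> ('a \<Rightarrow> real) \<Rightarrow> real" where
  "energy U p \<rho> u = (LINT x|lebesgue_on U. \<bar>u x\<bar> powr p * \<rho> x) +
      (LINT x|lebesgue_on U. norm (weak_gradient U u x) powr p * \<rho> x)"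

lemma sobolev_norm_eq: "sobolev_norm U p \<rho> u = energy U p \<rho> u powr (1 / p)"
  by (simp add: sobolev_norm_def energy_def)

lemma energy_nonneg:
  assumes "AE x in lebesgue_on U. 0 \<le> \<rho> x" shows "0 \<le> energy U p \<rho> u"
  unfolding energy_def
  by (intro add_nonneg_nonneg integral_nonneg_AE; use assms in eventually_elim; simp)

lemma weak_gradient_AE:
  assumes "open U" "has_weak_gradient U u g"
  shows "AE x in lebesgue_on U. weak_gradient U u x = g x"
proof -
  have "has_weak_gradient U u (weak_gradient U u)"
    unfolding weak_gradient_def using assms(2) by (metis someI)
  then show ?thesis using weak_gradient_unique assms by blast
qed

text \<open>
  The norm is defined through a chosen weak gradient; uniqueness almost everywhere permits any
  other one.
\<close>

lemma energy_eq:
  assumes "open U" "\<rho> \<in> borel_measurable (lebesgue_on U)" "has_weak_gradient U u g"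
  shows "energy U p \<rho> u = (LINT x|lebesgue_on U. \<bar>u x\<bar> powr p * \<rho> x) +
      (LINT x|lebesgue_on U. norm (g x) powr p * \<rho> x)"
proof -
  have "has_weak_gradient U u (weak_gradient U u)"
    unfolding weak_gradient_def using assms(3) by (metis someI)
  then have "weak_gradient U u \<in> borel_measurable (lebesgue_on U)" "g \<in> borel_measurable (lebesgue_on U)"
    using assms by (auto dest: has_weak_gradientD intro: locally_integrable_measurable)
  then have "(LINT x|lebesgue_on U. norm (weak_gradient U u x) powr p * \<rho> x) =
    (LINT x|lebesgue_on U. norm (g x) powr p * \<rho> x)"
    using weak_gradient_AE[OF assms(1,3)] assms(2) by (intro integral_cong_AE) auto
  then show ?thesis by (simp add: energy_def)
qed

lemma sobolevE:
  assumes "u \<in> sobolev U p \<rho>"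
  obtains g where "u \<in> Lp U p \<rho>" "has_weak_gradient U u g" "(\<lambda>x. norm (g x)) \<in> Lp U p \<rho>"
  using assms by (auto simp: sobolev_def)

lemma sobolev_combination:
  assumes "open U" "0 \<le> p" and \<rho>: "\<rho> \<in> borel_measurable (lebesgue_on U)" "AE x in lebesgue_on U. 0 \<le> \<rho> x"
    and "u \<in> sobolev U p \<rho>" "v \<in> sobolev U p \<rho>"
  shows "(\<lambda>x. a * u x + b * v x) \<in> sobolev U p \<rho>"
    and "energy U p \<rho> (\<lambda>x. a * u x + b * v x) \<le>
      2 powr p * (\<bar>a\<bar> powr p * energy U p \<rho> u + \<bar>b\<bar> powr p * energy U p \<rho> v)"
proof -
  obtain g where g: "u \<in> Lp U p \<rho>" "has_weak_gradient U u g" "(\<lambda>x. norm (g x)) \<in> Lp U p \<rho>"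
    using sobolevE[OF assms(5)] .
  obtain h where h: "v \<in> Lp U p \<rho>" "has_weak_gradient U v h" "(\<lambda>x. norm (h x)) \<in> Lp U p \<rho>"
    using sobolevE[OF assms(6)] .
  let ?k = "\<lambda>x. a *\<^sub>R g x + b *\<^sub>R h x"
  have k: "has_weak_gradient U (\<lambda>x. a * u x + b * v x) ?k"
    using has_weak_gradient_combination[OF assms(1) g(2) h(2)] .
  have m: "(\<lambda>x. norm (?k x)) \<in> borel_measurable (lebesgue_on U)"
    using locally_integrable_measurable[OF assms(1) has_weak_gradientD(2)[OF k]] by measurable
  have le: "\<bar>norm (?k x)\<bar> \<le> \<bar>a\<bar> * \<bar>norm (g x)\<bar> + \<bar>b\<bar> * \<bar>norm (h x)\<bar>" for x
    using norm_triangle_ineq[of "a *\<^sub>R g x" "b *\<^sub>R h x"] by simp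
  note K = Lp_dominated_combination[OF assms(1,2) \<rho> g(3) h(3) m le]
  note L = Lp_combination[OF assms(1,2) \<rho> g(1) h(1), of a b]
  show "(\<lambda>x. a * u x + b * v x) \<in> sobolev U p \<rho>"
    using K(1) L(1) k by (auto simp: sobolev_def)
  have "energy U p \<rho> (\<lambda>x. a * u x + b * v x) \<le>
    2 powr p * (\<bar>a\<bar> powr p * (LINT x|lebesgue_on U. \<bar>u x\<bar> powr p * \<rho> x)
                + \<bar>b\<bar> powr p * (LINT x|lebesgue_on U. \<bar>v x\<bar> powr p * \<rho> x)) +
    2 powr p * (\<bar>a\<bar> powr p * (LINT x|lebesgue_on U. norm (g x) powr p * \<rho> x)
                + \<bar>b\<bar> powr p * (LINT x|lebesgue_on U. norm (h x) powr p * \<rho> x))"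
    using K(2) L(2) by (simp add: energy_eq[OF assms(1) \<rho>(1) k])
  also have "\<dots> = 2 powr p * (\<bar>a\<bar> powr p * energy U p \<rho> u + \<bar>b\<bar> powr p * energy U p \<rho> v)"
    by (simp add: energy_eq[OF assms(1) \<rho>(1) g(2)] energy_eq[OF assms(1) \<rho>(1) h(2)] algebra_simps)
  finally show "energy U p \<rho> (\<lambda>x. a * u x + b * v x) \<le>
      2 powr p * (\<bar>a\<bar> powr p * energy U p \<rho> u + \<bar>b\<bar> powr p * energy U p \<rho> v)" .
qed

lemma energy_AE_zero:
  assumes "open U" "\<rho> \<in> borel_measurable (lebesgue_on U)" "u \<in> sobolev U p \<rho>"
    and zero: "AE x in lebesgue_on U. u x = 0"
  shows "energy U p \<rho> u = 0"
proof -
  obtain g where g: "u \<in> Lp U p \<rho>" "has_weak_gradient U u g" using sobolevE[OF assms(3)] by metis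
  have "has_weak_gradient U u (\<lambda>_. 0)"
    unfolding has_weak_gradient_def
  proof (intro conjI ballI)
    show "locally_integrable U u" by (rule has_weak_gradientD(1)[OF g(2)])
    show "locally_integrable U (\<lambda>_. 0)" by (rule locally_integrable_continuous) simp
    show "(LINT x|lebesgue_on U. u x * frechet_derivative \<phi> (at x) i) =
      - (LINT x|lebesgue_on U. (0 \<bullet> i) * \<phi> x)" for \<phi> i
    proof -
      have "(LINT x|lebesgue_on U. u x * frechet_derivative \<phi> (at x) i) = 0"
        using zero by (intro integral_eq_zero_AE) auto
      then show ?thesis by simp
    qed
  qed
  then have "energy U p \<rho> u = (LINT x|lebesgue_on U. \<bar>u x\<bar> powr p * \<rho> x)"
    using energy_eq[OF assms(1,2)] by fastforce
  also have "\<dots> = 0" using zero by (intro integral_eq_zero_AE) auto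
  finally show ?thesis .
qed

text \<open>
  The iterated derivatives are formed for functions on the whole space, while \<open>f\<close> and \<open>g\<close> are
  smooth only on \<open>U\<close>; differentiability is carried along in the induction because it justifies
  the next derivative.
\<close>

lemma iter_deriv_combination:
  assumes "open U" "smooth_on U f" "smooth_on U g" "is \<in> lists Basis" "x \<in> U"
  shows "iter_deriv is (\<lambda>x. a * f x + b * g x) x = a * iter_deriv is f x + b * iter_deriv is g x"
    and "iter_deriv is (\<lambda>x. a * f x + b * g x) differentiable (at x)"
proof -
  let ?k = "\<lambda>x. a * f x + b * g x"
  have "iter_deriv is ?k x = a * iter_deriv is f x + b * iter_deriv is g x \<and>
        (iter_deriv is ?k has_derivative (\<lambda>h. a * frechet_derivative (iter_deriv is f) (at x) h +
            b * frechet_derivative (iter_deriv is g) (at x) h)) (at x)"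
    using assms(4,5)
  proof (induction "is" arbitrary: x rule: list.induct)
    case (Cons i "is")
    let ?js = "i # is"
    have val: "iter_deriv ?js ?k y = a * iter_deriv ?js f y + b * iter_deriv ?js g y" if "y \<in> U" for y
    proof -
      have "is \<in> lists Basis" using Cons.prems(1) by (rule listsE)
      from Cons.IH[OF this that] show ?thesis
        by (auto dest!: frechet_derivative_at[symmetric])
    qed
    have D: "(iter_deriv ?js f has_derivative frechet_derivative (iter_deriv ?js f) (at x)) (at x)"
      "(iter_deriv ?js g has_derivative frechet_derivative (iter_deriv ?js g) (at x)) (at x)"
      using assms(2,3) Cons.prems unfolding smooth_on_def by (meson frechet_derivative_works)+
    have "((\<lambda>y. a * iter_deriv ?js f y + b * iter_deriv ?js g y) has_derivative
      (\<lambda>h. a * frechet_derivative (iter_deriv ?js f) (at x) h +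
            b * frechet_derivative (iter_deriv ?js g) (at x) h)) (at x)"
      by (intro has_derivative_add has_derivative_mult_right D)
    then have "(iter_deriv ?js ?k has_derivative
      (\<lambda>h. a * frechet_derivative (iter_deriv ?js f) (at x) h +
            b * frechet_derivative (iter_deriv ?js g) (at x) h)) (at x)"
      by (rule has_derivative_transform_within_open[OF _ assms(1) Cons.prems(2)]) (simp only: val)
    with val[OF Cons.prems(2)] show ?case by blast
  next
    case Nil
    then show ?case
      using smooth_onD(1)[OF assms(2)] smooth_onD(1)[OF assms(3)]
      by (auto intro!: has_derivative_add has_derivative_mult_right)
  qed
  then show "iter_deriv is ?k x = a * iter_deriv is f x + b * iter_deriv is g x"
    and "iter_deriv is ?k differentiable (at x)"
    by (auto simp: differentiable_def)
qed

lemma test_functions_upto_combination: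
  assumes "open U" and f: "f \<in> test_functions_upto U K" and g: "g \<in> test_functions_upto U K"
  shows "(\<lambda>x. a * f x + b * g x) \<in> test_functions_upto U K" (is "?k \<in> _")
proof -
  have sf: "smooth_on U f" and sg: "smooth_on U g"
    using f g by (auto simp: test_functions_upto_def smooth_on_closure_def)
  note ID = iter_deriv_combination[OF assms(1) sf sg]
  have "smooth_on_closure U ?k"
    unfolding smooth_on_closure_def
  proof (intro conjI ballI)
    show "smooth_on U ?k" unfolding smooth_on_def using ID(2) by blast
    show "continuous_on (closure U) ?k"
      using f g by (auto simp: test_functions_upto_def smooth_on_closure_def intro!: continuous_intros)
    fix "is" :: "'a list" assume "is": "is \<in> lists Basis"
    obtain f' g' where "continuous_on (closure U) f'" "\<forall>x\<in>U. f' x = iter_deriv is f x"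
      "continuous_on (closure U) g'" "\<forall>x\<in>U. g' x = iter_deriv is g x"
      using f g "is" unfolding test_functions_upto_def smooth_on_closure_def by blast
    then show "\<exists>k. continuous_on (closure U) k \<and> (\<forall>x\<in>U. k x = iter_deriv is ?k x)"
      using ID(1)[OF "is"] by (intro exI[of _ "\<lambda>x. a * f' x + b * g' x"]) (auto intro!: continuous_intros)
  qed
  moreover have "compact_support_in (closure U) K ?k"
  proof -
    let ?S = "\<lambda>f. closure {x \<in> closure U. f x \<noteq> (0::real)}"
    have "?S ?k \<subseteq> closure ({x \<in> closure U. f x \<noteq> 0} \<union> {x \<in> closure U. g x \<noteq> 0})"
      by (rule closure_mono) auto
    then have sub: "?S ?k \<subseteq> ?S f \<union> ?S g" by simp
    moreover have "compact (?S f \<union> ?S g)" "?S f \<union> ?S g \<subseteq> K"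
      using f g by (auto simp: test_functions_upto_def compact_support_in_def)
    moreover from sub this(1) have "compact (?S ?k)"
      by (meson closed_closure compact_imp_bounded bounded_subset compact_eq_bounded_closed)
    ultimately show ?thesis by (auto simp: compact_support_in_def)
  qed
  ultimately show ?thesis by (simp add: test_functions_upto_def)
qed

lemma zero_in_test_functions_upto: "(\<lambda>_. 0) \<in> test_functions_upto U K"
proof -
  have "iter_deriv is (\<lambda>_. 0) = (\<lambda>_. 0)" for "is" :: "'a list"
    by (induction "is") auto
  then show ?thesis
    by (auto simp: test_functions_upto_def smooth_on_closure_def smooth_on_def compact_support_in_def
        intro!: exI[of _ "\<lambda>_. 0"])
qed

lemma zero_in_sobolev: "(\<lambda>_. 0) \<in> sobolev U p \<rho>"
  by (auto simp: sobolev_def Lp_def has_weak_gradient_def intro!: locally_integrable_continuous exI[of _ "\<lambda>_. 0"])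

section \<open>Extension of a bounded linear map from a dense subspace\<close>

text \<open>
  The \<open>p\<close>-th power of the norm of the weighted Lebesgue space.
\<close>

definition Lp_energy :: "'a::euclidean_space set \<Rightarrow> real \<Rightarrow> ('a \<Rightarrow> real) \<Rightarrow> ('a \<Rightarrow> real) \<Rightarrow> real" where
  "Lp_energy V p \<rho> f = (LINT x|lebesgue_on V. \<bar>f x\<bar> powr p * \<rho> x)"

lemma Lp_energy_nonneg:
  assumes "AE x in lebesgue_on V. 0 \<le> \<rho> x" shows "0 \<le> Lp_energy V p \<rho> f"
  unfolding Lp_energy_def by (intro integral_nonneg_AE; use assms in eventually_elim; simp)

lemma Lp_energy_zeroD:
  assumes "0 < p" "AE x in lebesgue_on V. 0 < \<rho> x" "f \<in> Lp V p \<rho>" "Lp_energy V p \<rho> f \<le> 0"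
  shows "AE x in lebesgue_on V. f x = 0"
proof -
  have int: "integrable (lebesgue_on V) (\<lambda>x. \<bar>f x\<bar> powr p * \<rho> x)"
    using assms(3) by (simp add: Lp_def)
  have nn: "AE x in lebesgue_on V. 0 \<le> \<bar>f x\<bar> powr p * \<rho> x"
    using assms(2) by eventually_elim simp
  have "(LINT x|lebesgue_on V. \<bar>f x\<bar> powr p * \<rho> x) = 0"
    using assms(4) integral_nonneg_AE[OF nn] by (simp add: Lp_energy_def)
  then have "AE x in lebesgue_on V. \<bar>f x\<bar> powr p * \<rho> x = 0"
    using integral_nonneg_eq_0_iff_AE[OF int nn] by simp
  with assms(2) show ?thesis
    by eventually_elim (use \<open>0 < p\<close> in auto)
qed

lemma nn_integral_Lp_energy:
  assumes "AE x in lebesgue_on V. 0 \<le> \<rho> x" "f \<in> Lp V p \<rho>"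
  shows "(\<integral>\<^sup>+x. ennreal (\<bar>f x\<bar> powr p * \<rho> x) \<partial>lebesgue_on V) = ennreal (Lp_energy V p \<rho> f)"
  unfolding Lp_energy_def
  by (rule nn_integral_eq_integral) (use assms in \<open>auto simp: Lp_def\<close>)

text \<open>
  The series of \<open>(2 ^ n * \<bar>f (Suc n) x - f n x\<bar>) powr p * \<rho> x\<close> has a finite integral and hence
  converges for almost every \<open>x\<close>. Its terms are then bounded, so the increments decay like
  \<open>(1/2) ^ n\<close>.
\<close>

lemma Lp_fast_Cauchy_AE_convergent:
  assumes "0 < p" and \<rho>: "\<rho> \<in> borel_measurable (lebesgue_on V)" "AE x in lebesgue_on V. 0 < \<rho> x"
    and d: "\<And>n. (\<lambda>x. f (Suc n) x - f n x) \<in> Lp V p \<rho>"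
    and fast: "\<And>n. Lp_energy V p \<rho> (\<lambda>x. f (Suc n) x - f n x) \<le> (1/2) ^ n * ((1/2) ^ n) powr p"
  shows "AE x in lebesgue_on V. convergent (\<lambda>n. f n x)"
proof -
  let ?M = "lebesgue_on V"
  define g where "g n x = (2 ^ n) powr p * (\<bar>f (Suc n) x - f n x\<bar> powr p * \<rho> x)" for n x
  have \<rho>0: "AE x in ?M. 0 \<le> \<rho> x" using \<rho>(2) by eventually_elim simp
  have dp: "(\<lambda>x. \<bar>f (Suc n) x - f n x\<bar> powr p * \<rho> x) \<in> borel_measurable ?M" for n
    using d[of n] by (auto simp: Lp_def dest: borel_measurable_integrable)
  then have [measurable]: "g n \<in> borel_measurable ?M" for n
    unfolding g_def by (rule borel_measurable_times[OF borel_measurable_const])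
  have "(\<integral>\<^sup>+x. ennreal (g n x) \<partial>?M) \<le> ennreal ((1/2) ^ n)" for n
  proof -
    have "(\<integral>\<^sup>+x. ennreal (g n x) \<partial>?M) =
      (\<integral>\<^sup>+x. ennreal ((2 ^ n) powr p) * ennreal (\<bar>f (Suc n) x - f n x\<bar> powr p * \<rho> x) \<partial>?M)"
      by (simp add: g_def ennreal_mult')
    also have "\<dots> = ennreal ((2 ^ n) powr p) * (\<integral>\<^sup>+x. ennreal (\<bar>f (Suc n) x - f n x\<bar> powr p * \<rho> x) \<partial>?M)"
      using dp by (intro nn_integral_cmult) simp
    also have "\<dots> = ennreal ((2 ^ n) powr p * Lp_energy V p \<rho> (\<lambda>x. f (Suc n) x - f n x))"
      using nn_integral_Lp_energy[OF \<rho>0 d[of n]] by (simp add: ennreal_mult')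
    also have "\<dots> \<le> ennreal ((2 ^ n) powr p * ((1/2) ^ n * ((1/2) ^ n) powr p))"
      by (intro ennreal_leI mult_left_mono fast) simp
    also have "(2 ^ n) powr p * ((1/2) ^ n * ((1/2) ^ n) powr p) = (1/2::real) ^ n"
      by (simp add: powr_mult[symmetric] power_mult_distrib[symmetric] flip: mult.assoc)
    finally show ?thesis .
  qed
  then have "(\<Sum>n. \<integral>\<^sup>+x. ennreal (g n x) \<partial>?M) \<le> (\<Sum>n. ennreal ((1/2) ^ n))"
    by (intro suminf_le) auto
  also have "\<dots> = ennreal (\<Sum>n. (1/2) ^ n)"
    by (intro suminf_ennreal2) auto
  finally have "(\<integral>\<^sup>+x. (\<Sum>n. ennreal (g n x)) \<partial>?M) < \<infinity>"
    by (subst nn_integral_suminf) (auto simp: less_top[symmetric] top_unique)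
  then have "AE x in ?M. (\<Sum>n. ennreal (g n x)) \<noteq> \<infinity>"
    by (intro nn_integral_noteq_infinite) auto
  with \<rho>(2) show ?thesis
  proof eventually_elim
    case (elim x)
    then have gnn: "0 \<le> g n x" for n by (simp add: g_def)
    have sg: "summable (\<lambda>n. g n x)"
      using elim gnn by (intro summable_suminf_not_top) auto
    define B where "B = (\<Sum>n. g n x)"
    have gB: "g n x \<le> B" for n
      unfolding B_def using sum_le_suminf[OF sg, of "{n}"] gnn by auto
    have le: "norm (f (Suc n) x - f n x) \<le> (B / \<rho> x) powr (1/p) * (1/2) ^ n" for n
    proof -
      have "(2 ^ n * \<bar>f (Suc n) x - f n x\<bar>) powr p \<le> B / \<rho> x"
        using gB[of n] elim by (simp add: g_def powr_mult field_simps)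
      then have "((2 ^ n * \<bar>f (Suc n) x - f n x\<bar>) powr p) powr (1/p) \<le> (B / \<rho> x) powr (1/p)"
        using \<open>0 < p\<close> by (intro powr_mono2) auto
      then show ?thesis
        using \<open>0 < p\<close> by (simp add: powr_powr field_simps power_one_over)
    qed
    have "summable (\<lambda>n. (B / \<rho> x) powr (1/p) * (1/2) ^ n)"
      by (rule summable_mult[OF summable_geometric]) simp
    from summable_comparison_test'[OF this le]
    have "summable (\<lambda>n. f (Suc n) x - f n x)" .
    then have "convergent (\<lambda>n. \<Sum>i<n. f (Suc i) x - f i x)"
      by (simp add: summable_iff_convergent)
    then have "convergent (\<lambda>n. f n x - f 0 x)"
      using sum_lessThan_telescope[of "\<lambda>n. f n x"] by simp
    then show ?case by (simp add: convergent_diff_const_right_iff)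
  qed
qed

text \<open>
  This is Fatou's lemma.
\<close>

lemma Lp_energy_limit_le:
  assumes "open V" "0 < p" and \<rho>: "\<rho> \<in> borel_measurable (lebesgue_on V)" "AE x in lebesgue_on V. 0 < \<rho> x"
    and f: "\<And>n. f n \<in> Lp V p \<rho>" and g: "g \<in> Lp V p \<rho>" and t: "t \<in> borel_measurable (lebesgue_on V)"
    and lim: "AE x in lebesgue_on V. (\<lambda>n. f n x) \<longlonglongrightarrow> t x"
    and le: "\<And>n. Lp_energy V p \<rho> (\<lambda>x. f n x - g x) \<le> b n" and b: "b \<longlonglongrightarrow> B"
  shows "(\<lambda>x. t x - g x) \<in> Lp V p \<rho>" "Lp_energy V p \<rho> (\<lambda>x. t x - g x) \<le> B"
proof -
  let ?M = "lebesgue_on V"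
  have \<rho>0: "AE x in ?M. 0 \<le> \<rho> x" using \<rho>(2) by eventually_elim simp
  have [measurable]: "f n \<in> borel_measurable ?M" "g \<in> borel_measurable ?M" for n
    using f g by (auto simp: Lp_def)
  note [measurable] = t \<rho>(1)
  have fg: "(\<lambda>x. f n x - g x) \<in> Lp V p \<rho>" for n
    using Lp_combination(1)[OF assms(1) _ \<rho>(1) \<rho>0 f g, where a = 1 and b = "-1"] \<open>0 < p\<close> by simp
  have b0: "0 \<le> b n" for n using le[of n] Lp_energy_nonneg[OF \<rho>0] order_trans by blast
  then have B0: "0 \<le> B" using b by (intro LIMSEQ_le_const[OF b]) blast
  have "(\<integral>\<^sup>+x. ennreal (\<bar>t x - g x\<bar> powr p * \<rho> x) \<partial>?M) =
    (\<integral>\<^sup>+x. liminf (\<lambda>n. ennreal (\<bar>f n x - g x\<bar> powr p * \<rho> x)) \<partial>?M)"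
  proof (rule nn_integral_cong_AE)
    show "AE x in ?M. ennreal (\<bar>t x - g x\<bar> powr p * \<rho> x) = liminf (\<lambda>n. ennreal (\<bar>f n x - g x\<bar> powr p * \<rho> x))"
      using lim
    proof eventually_elim
      case (elim x)
      have "(\<lambda>n. ennreal (\<bar>f n x - g x\<bar> powr p * \<rho> x)) \<longlonglongrightarrow> ennreal (\<bar>t x - g x\<bar> powr p * \<rho> x)"
        using \<open>0 < p\<close> by (intro tendsto_ennrealI tendsto_mult tendsto_powr2 tendsto_rabs tendsto_diff elim tendsto_const) auto
      then show ?case by (simp add: lim_imp_Liminf)
    qed
  qed
  also have "\<dots> \<le> liminf (\<lambda>n. \<integral>\<^sup>+x. ennreal (\<bar>f n x - g x\<bar> powr p * \<rho> x) \<partial>?M)"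
    by (rule nn_integral_liminf) measurable
  also have "\<dots> \<le> liminf (\<lambda>n. ennreal (b n))"
    using le nn_integral_Lp_energy[OF \<rho>0 fg]
    by (intro Liminf_mono always_eventually) (simp add: ennreal_leI)
  also have "\<dots> = ennreal B"
    using b by (intro lim_imp_Liminf) auto
  finally have *: "(\<integral>\<^sup>+x. ennreal (\<bar>t x - g x\<bar> powr p * \<rho> x) \<partial>?M) \<le> ennreal B" .
  have int: "integrable ?M (\<lambda>x. \<bar>t x - g x\<bar> powr p * \<rho> x)"
  proof (rule integrableI_nonneg)
    show "AE x in ?M. 0 \<le> \<bar>t x - g x\<bar> powr p * \<rho> x" using \<rho>0 by eventually_elim simp
    show "(\<integral>\<^sup>+x. ennreal (\<bar>t x - g x\<bar> powr p * \<rho> x) \<partial>?M) < \<infinity>"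
      using * by (simp add: le_less_trans)
  qed measurable
  then show L: "(\<lambda>x. t x - g x) \<in> Lp V p \<rho>" by (simp add: Lp_def)
  show "Lp_energy V p \<rho> (\<lambda>x. t x - g x) \<le> B"
    using * B0 nn_integral_Lp_energy[OF \<rho>0 L] by simp
qed

text \<open>
  The abstract situation: \<open>tr\<close> is linear on a linear subspace \<open>D\<close> of \<open>S\<close> and bounded from \<open>N\<close> to
  the weighted Lebesgue space. Here \<open>N\<close> stands for the \<open>p\<close>-th power of a norm, whence the
  quasi-triangle inequality with a constant \<open>K\<close>; linear combinations in one hypothesis cover
  sums, differences and multiples.
\<close>

locale dense_bounded_map =
  fixes U :: "'b::euclidean_space set" and V :: "'a::euclidean_space set"
    and p :: real and \<rho> :: "'a \<Rightarrow> real"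
    and S D :: "('b \<Rightarrow> real) set" and N :: "('b \<Rightarrow> real) \<Rightarrow> real"
    and tr :: "('b \<Rightarrow> real) \<Rightarrow> 'a \<Rightarrow> real" and K C :: real
  assumes V: "open V" and p: "0 < p"
    and \<rho>: "\<rho> \<in> borel_measurable (lebesgue_on V)" "AE x in lebesgue_on V. 0 < \<rho> x"
    and S_comb: "\<And>u v a b. u \<in> S \<Longrightarrow> v \<in> S \<Longrightarrow> (\<lambda>z. a * u z + b * v z) \<in> S"
    and N_nonneg: "\<And>u. 0 \<le> N u"
    and N_comb: "\<And>u v a b. u \<in> S \<Longrightarrow> v \<in> S \<Longrightarrow>
      N (\<lambda>z. a * u z + b * v z) \<le> K * (\<bar>a\<bar> powr p * N u + \<bar>b\<bar> powr p * N v)"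
    and K: "0 \<le> K"
    and N_null: "\<And>u. u \<in> S \<Longrightarrow> AE z in lebesgue_on U. u z = 0 \<Longrightarrow> N u = 0"
    and D_S: "D \<subseteq> S"
    and D_comb: "\<And>u v a b. u \<in> D \<Longrightarrow> v \<in> D \<Longrightarrow> (\<lambda>z. a * u z + b * v z) \<in> D"
    and D_zero: "(\<lambda>_. 0) \<in> D"
    and tr_comb: "\<And>u v a b x. u \<in> D \<Longrightarrow> v \<in> D \<Longrightarrow>
      tr (\<lambda>z. a * u z + b * v z) x = a * tr u x + b * tr v x"
    and tr_Lp: "\<And>u. u \<in> D \<Longrightarrow> tr u \<in> Lp V p \<rho>"
    and tr_bound: "\<And>u. u \<in> D \<Longrightarrow> Lp_energy V p \<rho> (tr u) \<le> C * N u"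
    and C: "0 \<le> C"
begin

abbreviation J :: "('a \<Rightarrow> real) \<Rightarrow> real" where "J \<equiv> Lp_energy V p \<rho>"

definition X :: "('b \<Rightarrow> real) set" where
  "X = {u \<in> S. \<forall>\<epsilon>>0. \<exists>v\<in>D. N (\<lambda>z. u z - v z) < \<epsilon>}"

text \<open>
  This condition determines \<open>t\<close> up to a null set when \<open>u\<close> is in the closure of \<open>D\<close>, and the
  operator is defined by choosing such a \<open>t\<close>.
\<close>

definition extends_trace :: "real \<Rightarrow> ('b \<Rightarrow> real) \<Rightarrow> ('a \<Rightarrow> real) \<Rightarrow> bool" where
  "extends_trace B u t \<longleftrightarrow> 0 \<le> B \<and> t \<in> Lp V p \<rho> \<and>
     (\<forall>v\<in>D. J (\<lambda>x. t x - tr v x) \<le> B * N (\<lambda>z. u z - v z))"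

lemma \<rho>0: "AE x in lebesgue_on V. 0 \<le> \<rho> x"
  using \<rho>(2) by eventually_elim simp

lemma S_diff: "u \<in> S \<Longrightarrow> v \<in> S \<Longrightarrow> (\<lambda>z. u z - v z) \<in> S"
  using S_comb[of u v 1 "-1"] by simp

lemma D_in_S: "v \<in> D \<Longrightarrow> v \<in> S" using D_S by blast

lemma Lp_comb: "f \<in> Lp V p \<rho> \<Longrightarrow> g \<in> Lp V p \<rho> \<Longrightarrow> (\<lambda>x. a * f x + b * g x) \<in> Lp V p \<rho>"
  using Lp_combination(1)[OF V _ \<rho>(1) \<rho>0] p by simp

lemma Lp_diff: "f \<in> Lp V p \<rho> \<Longrightarrow> g \<in> Lp V p \<rho> \<Longrightarrow> (\<lambda>x. f x - g x) \<in> Lp V p \<rho>"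
  using Lp_comb[of f g 1 "-1"] by simp

lemma J_comb: "f \<in> Lp V p \<rho> \<Longrightarrow> g \<in> Lp V p \<rho> \<Longrightarrow>
    J (\<lambda>x. a * f x + b * g x) \<le> 2 powr p * (\<bar>a\<bar> powr p * J f + \<bar>b\<bar> powr p * J g)"
  using Lp_combination(2)[OF V _ \<rho>(1) \<rho>0] p by (simp add: Lp_energy_def)

lemma D_X: "v \<in> D \<Longrightarrow> v \<in> X"
  using N_null[of "\<lambda>z. 0"] D_in_S[OF D_zero] D_in_S unfolding X_def by force

lemma approximate_combination:
  assumes "u \<in> X" "v \<in> X"
  shows "\<exists>L\<ge>0. \<forall>\<epsilon>>0. \<exists>u'\<in>D. \<exists>v'\<in>D. N (\<lambda>z. u z - u' z) < \<epsilon> \<and> N (\<lambda>z. v z - v' z) < \<epsilon> \<and>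
    N (\<lambda>z. (a * u z + b * v z) - (a * u' z + b * v' z)) \<le> L * \<epsilon>"
proof (intro exI[of _ "K * (\<bar>a\<bar> powr p + \<bar>b\<bar> powr p)"] conjI allI impI)
  show "0 \<le> K * (\<bar>a\<bar> powr p + \<bar>b\<bar> powr p)" using K by simp
  fix \<epsilon> :: real assume "0 < \<epsilon>"
  then obtain u' v' where uv: "u' \<in> D" "v' \<in> D" "N (\<lambda>z. u z - u' z) < \<epsilon>" "N (\<lambda>z. v z - v' z) < \<epsilon>"
    using assms unfolding X_def by blast
  have "N (\<lambda>z. (a * u z + b * v z) - (a * u' z + b * v' z)) =
    N (\<lambda>z. a * (u z - u' z) + b * (v z - v' z))" by (simp add: algebra_simps)
  also have "\<dots> \<le> K * (\<bar>a\<bar> powr p * N (\<lambda>z. u z - u' z) + \<bar>b\<bar> powr p * N (\<lambda>z. v z - v' z))"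
    using assms uv D_in_S by (intro N_comb S_diff) (auto simp: X_def)
  also have "\<dots> \<le> K * (\<bar>a\<bar> powr p * \<epsilon> + \<bar>b\<bar> powr p * \<epsilon>)"
    using uv K by (intro mult_left_mono add_mono) auto
  finally show "\<exists>u'\<in>D. \<exists>v'\<in>D. N (\<lambda>z. u z - u' z) < \<epsilon> \<and> N (\<lambda>z. v z - v' z) < \<epsilon> \<and>
    N (\<lambda>z. (a * u z + b * v z) - (a * u' z + b * v' z)) \<le> K * (\<bar>a\<bar> powr p + \<bar>b\<bar> powr p) * \<epsilon>"
    using uv by (intro bexI[of _ u'] bexI[of _ v']) (auto simp: algebra_simps)
qed

lemma X_comb:
  assumes "u \<in> X" "v \<in> X" shows "(\<lambda>z. a * u z + b * v z) \<in> X"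
  unfolding X_def
proof (intro CollectI conjI allI impI)
  show "(\<lambda>z. a * u z + b * v z) \<in> S" using assms S_comb by (auto simp: X_def)
  fix \<epsilon> :: real assume \<epsilon>: "0 < \<epsilon>"
  obtain L where L: "L \<ge> 0" "\<forall>\<epsilon>>0. \<exists>u'\<in>D. \<exists>v'\<in>D. N (\<lambda>z. u z - u' z) < \<epsilon> \<and> N (\<lambda>z. v z - v' z) < \<epsilon> \<and>
    N (\<lambda>z. (a * u z + b * v z) - (a * u' z + b * v' z)) \<le> L * \<epsilon>"
    using approximate_combination[OF assms] by blast
  have "0 < \<epsilon> / (L + 1)" using L(1) \<epsilon> by simp
  then obtain u' v' where uv: "u' \<in> D" "v' \<in> D"
    "N (\<lambda>z. (a * u z + b * v z) - (a * u' z + b * v' z)) \<le> L * (\<epsilon> / (L + 1))"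
    using L(2) by blast
  have "L * (\<epsilon> / (L + 1)) < \<epsilon>" using L(1) \<epsilon> by (simp add: field_simps)
  with uv show "\<exists>v'\<in>D. N (\<lambda>z. (a * u z + b * v z) - v' z) < \<epsilon>"
    using D_comb[OF uv(1,2), of a b] by (intro bexI[of _ "\<lambda>z. a * u' z + b * v' z"]) auto
qed

lemma X_diff: "u \<in> X \<Longrightarrow> v \<in> X \<Longrightarrow> (\<lambda>z. u z - v z) \<in> X"
  using X_comb[of u v 1 "-1"] by simp

text \<open>
  Approximate \<open>u\<close> so fast that the traces of the approximations converge almost everywhere; the
  defining inequality passes to the limit by Fatou's lemma.
\<close>

lemma extends_trace_exists:
  assumes "u \<in> X" shows "\<exists>t. extends_trace (C * K) u t"
proof -
  \<comment> \<open>The factor \<open>((1/2) ^ n) powr p\<close> makes the increments themselves summable almost everywhere; \<open>+ 1\<close> below keeps the denominator positive.\<close>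
  define \<delta> :: "nat \<Rightarrow> real" where "\<delta> n = (1/2) ^ n * ((1/2) ^ n) powr p" for n
  define \<epsilon> where "\<epsilon> n = \<delta> n / (2 * (C * K) + 1)" for n
  have CK: "0 \<le> C * K" using C K by simp
  have \<delta>pos: "0 < \<delta> n" for n by (simp add: \<delta>_def)
  have \<delta>dec: "\<delta> (Suc n) \<le> \<delta> n" for n
    unfolding \<delta>_def using p by (intro mult_mono powr_mono2) auto
  have \<epsilon>pos: "0 < \<epsilon> n" and \<epsilon>dec: "\<epsilon> (Suc n) \<le> \<epsilon> n" for n
    using \<delta>pos[of n] \<delta>dec[of n] CK by (auto simp: \<epsilon>_def divide_right_mono)
  have "\<delta> \<longlonglongrightarrow> 0"
  proof (rule tendsto_sandwich[of "\<lambda>_. 0" _ _ "\<lambda>n. (1/2::real) ^ n"])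
    have "\<delta> n \<le> (1/2) ^ n * 1" for n
      unfolding \<delta>_def using p by (intro mult_left_mono powr_le1) (auto simp: power_le_one)
    then show "\<forall>\<^sub>F n in sequentially. \<delta> n \<le> (1/2) ^ n" by simp
  qed (auto intro!: LIMSEQ_power_zero always_eventually less_imp_le[OF \<delta>pos])
  then have \<epsilon>0: "\<epsilon> \<longlonglongrightarrow> 0"
    unfolding \<epsilon>_def by (intro tendsto_divide_zero)
  have "\<forall>n. \<exists>v\<in>D. N (\<lambda>z. u z - v z) < \<epsilon> n"
    using assms \<epsilon>pos by (auto simp: X_def)
  then obtain v where v: "\<And>n. v n \<in> D" "\<And>n. N (\<lambda>z. u z - v n z) < \<epsilon> n" by metis
  have uS: "u \<in> S" using assms by (simp add: X_def)
  have J_le: "J (\<lambda>x. tr (v n) x - tr w x) \<le> C * K * (N (\<lambda>z. u z - w z) + N (\<lambda>z. u z - v n z))"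
    if "w \<in> D" for n w
  proof -
    have "J (\<lambda>x. tr (v n) x - tr w x) = J (tr (\<lambda>z. 1 * v n z + (-1) * w z))"
      by (intro arg_cong[where f = J] ext, subst tr_comb[OF v(1) that]) simp
    also have "\<dots> \<le> C * N (\<lambda>z. 1 * v n z + (-1) * w z)"
      using v(1) that by (intro tr_bound D_comb)
    also have "(\<lambda>z. 1 * v n z + (-1) * w z) = (\<lambda>z. 1 * (u z - w z) + (-1) * (u z - v n z))"
      by (simp add: algebra_simps)
    also have "C * N \<dots> \<le> C * (K * (\<bar>1\<bar> powr p * N (\<lambda>z. u z - w z) + \<bar>-1\<bar> powr p * N (\<lambda>z. u z - v n z)))"
      using C uS v(1) that D_in_S by (intro mult_left_mono N_comb S_diff) auto
    finally show ?thesis by (simp add: mult.assoc)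
  qed
  have fast: "J (\<lambda>x. tr (v (Suc n)) x - tr (v n) x) \<le> \<delta> n" for n
  proof -
    have "J (\<lambda>x. tr (v (Suc n)) x - tr (v n) x) \<le> C * K * (\<epsilon> n + \<epsilon> n)"
      using v(2)[of n] v(2)[of "Suc n"] \<epsilon>dec[of n] CK
      by (intro order_trans[OF J_le[OF v(1)]] mult_left_mono) auto
    also have "\<dots> = 2 * (C * K) / (2 * (C * K) + 1) * \<delta> n" by (simp add: \<epsilon>_def)
    also have "\<dots> \<le> 1 * \<delta> n"
      using CK \<delta>pos[of n] by (intro mult_right_mono) auto
    finally have "J (\<lambda>x. tr (v (Suc n)) x - tr (v n) x) \<le> 1 * \<delta> n" .
    then show ?thesis by simp
  qed
  have conv: "AE x in lebesgue_on V. convergent (\<lambda>n. tr (v n) x)"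
    by (rule Lp_fast_Cauchy_AE_convergent[OF p \<rho>, of "\<lambda>n. tr (v n)"])
       (use fast Lp_diff tr_Lp v(1) in \<open>auto simp: \<delta>_def\<close>)
  define t where "t x = lim (\<lambda>n. tr (v n) x)" for x
  have t: "t \<in> borel_measurable (lebesgue_on V)"
    unfolding t_def using tr_Lp[OF v(1)] by (intro borel_measurable_lim_metric) (auto simp: Lp_def)
  have lim: "AE x in lebesgue_on V. (\<lambda>n. tr (v n) x) \<longlonglongrightarrow> t x"
    using conv by eventually_elim (simp add: t_def convergent_LIMSEQ_iff)
  have limit: "(\<lambda>x. t x - tr w x) \<in> Lp V p \<rho>" "J (\<lambda>x. t x - tr w x) \<le> C * K * N (\<lambda>z. u z - w z)"
    if w: "w \<in> D" for w
  proof -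
    have b: "J (\<lambda>x. tr (v n) x - tr w x) \<le> C * K * (N (\<lambda>z. u z - w z) + \<epsilon> n)" for n
      using v(2)[of n] CK by (intro order_trans[OF J_le[OF w]] mult_left_mono) auto
    have "(\<lambda>n. C * K * (N (\<lambda>z. u z - w z) + \<epsilon> n)) \<longlonglongrightarrow> C * K * (N (\<lambda>z. u z - w z) + 0)"
      by (intro tendsto_intros \<epsilon>0)
    then have b0: "(\<lambda>n. C * K * (N (\<lambda>z. u z - w z) + \<epsilon> n)) \<longlonglongrightarrow> C * K * N (\<lambda>z. u z - w z)"
      by simp
    note L = Lp_energy_limit_le[OF V p \<rho> tr_Lp[OF v(1)] tr_Lp[OF w] t lim b b0]
    show "(\<lambda>x. t x - tr w x) \<in> Lp V p \<rho>" "J (\<lambda>x. t x - tr w x) \<le> C * K * N (\<lambda>z. u z - w z)"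
      by (fact L)+
  qed
  have "t \<in> Lp V p \<rho>"
    using Lp_comb[OF limit(1)[OF D_zero] tr_Lp[OF D_zero], of 1 1] by simp
  then show ?thesis
    using limit(2) CK unfolding extends_trace_def by blast
qed

text \<open>
  Compare both sides with the trace of one and the same combination of approximations. The three
  constants are unrelated, so that operators obtained in different ways can be compared.
  Instances: \<open>u3 = u1 + u2\<close> and \<open>u3 = c * u1\<close> give linearity, \<open>u3 = u1\<close> almost everywhere gives
  well-definedness and uniqueness.
\<close>

lemma extends_trace_combination:
  assumes X: "u1 \<in> X" "u2 \<in> X" and "u3 \<in> S"
    and t: "extends_trace B1 u1 t1" "extends_trace B2 u2 t2" "extends_trace B3 u3 t3"
    and u3: "AE z in lebesgue_on U. u3 z = a * u1 z + b * u2 z"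
  shows "AE x in lebesgue_on V. t3 x = a * t1 x + b * t2 x"
proof -
  have tL: "t1 \<in> Lp V p \<rho>" "t2 \<in> Lp V p \<rho>" "t3 \<in> Lp V p \<rho>" and B: "0 \<le> B1" "0 \<le> B2" "0 \<le> B3"
    using t by (auto simp: extends_trace_def)
  let ?t = "\<lambda>x. a * t1 x + b * t2 x" and ?u = "\<lambda>z. a * u1 z + b * u2 z"
  obtain L where L: "L \<ge> 0" "\<forall>\<epsilon>>0. \<exists>v1\<in>D. \<exists>v2\<in>D. N (\<lambda>z. u1 z - v1 z) < \<epsilon> \<and> N (\<lambda>z. u2 z - v2 z) < \<epsilon> \<and>
    N (\<lambda>z. ?u z - (a * v1 z + b * v2 z)) \<le> L * \<epsilon>"
    using approximate_combination[OF X] by blast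
  \<comment> \<open>The constant of the estimate in \<open>\<epsilon>\<close>: a comparison through \<open>u3\<close> plus comparisons through \<open>u1\<close> and \<open>u2\<close>.\<close>
  define A where "A = 2 powr p * (B3 * (K * L) + 2 powr p * (\<bar>a\<bar> powr p * B1 + \<bar>b\<bar> powr p * B2))"
  have uS: "?u \<in> S" using X by (auto simp: X_def intro: S_comb)
  have le: "J (\<lambda>x. t3 x - ?t x) \<le> A * \<epsilon>" if \<epsilon>: "0 < \<epsilon>" for \<epsilon>
  proof -
    obtain v1 v2 where v: "v1 \<in> D" "v2 \<in> D" "N (\<lambda>z. u1 z - v1 z) < \<epsilon>" "N (\<lambda>z. u2 z - v2 z) < \<epsilon>"
      "N (\<lambda>z. ?u z - (a * v1 z + b * v2 z)) \<le> L * \<epsilon>"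
      using L(2) \<epsilon> by blast
    let ?v = "\<lambda>z. a * v1 z + b * v2 z"
    have vD: "?v \<in> D" using v D_comb by blast
    have "N (\<lambda>z. u3 z - ?v z) = N (\<lambda>z. 1 * (u3 z - ?u z) + 1 * (?u z - ?v z))" by (simp add: algebra_simps)
    also have "\<dots> \<le> K * (\<bar>1\<bar> powr p * N (\<lambda>z. u3 z - ?u z) + \<bar>1\<bar> powr p * N (\<lambda>z. ?u z - ?v z))"
      using assms(3) uS vD by (intro N_comb S_diff) (auto dest: D_in_S)
    also have "N (\<lambda>z. u3 z - ?u z) = 0"
      using u3 by (intro N_null S_diff assms(3) uS) simp
    finally have "N (\<lambda>z. u3 z - ?v z) \<le> K * N (\<lambda>z. ?u z - ?v z)" by simp
    also have "\<dots> \<le> K * (L * \<epsilon>)" using v(5) K by (rule mult_left_mono)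
    finally have "B3 * N (\<lambda>z. u3 z - ?v z) \<le> B3 * (K * (L * \<epsilon>))" using B(3) by (rule mult_left_mono)
    moreover have "J (\<lambda>x. t3 x - tr ?v x) \<le> B3 * N (\<lambda>z. u3 z - ?v z)"
      using t(3) vD by (simp add: extends_trace_def)
    ultimately have 1: "J (\<lambda>x. t3 x - tr ?v x) \<le> B3 * (K * (L * \<epsilon>))" by linarith
    have i: "J (\<lambda>x. t1 x - tr v1 x) \<le> B1 * \<epsilon>" "J (\<lambda>x. t2 x - tr v2 x) \<le> B2 * \<epsilon>"
      using t(1,2) v B unfolding extends_trace_def by (meson less_imp_le mult_left_mono order_trans)+
    have "J (\<lambda>x. ?t x - tr ?v x) = J (\<lambda>x. a * (t1 x - tr v1 x) + b * (t2 x - tr v2 x))"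
      using v(1,2) by (simp add: tr_comb algebra_simps)
    also have "\<dots> \<le> 2 powr p * (\<bar>a\<bar> powr p * J (\<lambda>x. t1 x - tr v1 x) + \<bar>b\<bar> powr p * J (\<lambda>x. t2 x - tr v2 x))"
      using v(1,2) tL by (intro J_comb Lp_diff tr_Lp)
    also have "\<dots> \<le> 2 powr p * (\<bar>a\<bar> powr p * (B1 * \<epsilon>) + \<bar>b\<bar> powr p * (B2 * \<epsilon>))"
      using i by (intro mult_left_mono add_mono) auto
    finally have 2: "J (\<lambda>x. ?t x - tr ?v x) \<le> 2 powr p * (\<bar>a\<bar> powr p * (B1 * \<epsilon>) + \<bar>b\<bar> powr p * (B2 * \<epsilon>))" .
    have "J (\<lambda>x. t3 x - ?t x) = J (\<lambda>x. 1 * (t3 x - tr ?v x) + (-1) * (?t x - tr ?v x))"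
      by (simp add: algebra_simps)
    also have "\<dots> \<le> 2 powr p * (\<bar>1\<bar> powr p * J (\<lambda>x. t3 x - tr ?v x) + \<bar>-1\<bar> powr p * J (\<lambda>x. ?t x - tr ?v x))"
      using tL vD by (intro J_comb Lp_diff tr_Lp Lp_comb)
    also have "\<dots> \<le> 2 powr p * (B3 * (K * (L * \<epsilon>)) + 2 powr p * (\<bar>a\<bar> powr p * (B1 * \<epsilon>) + \<bar>b\<bar> powr p * (B2 * \<epsilon>)))"
      using 1 2 by (intro mult_left_mono) auto
    also have "\<dots> = A * \<epsilon>" by (simp add: A_def algebra_simps)
    finally show ?thesis .
  qed
  have A: "0 \<le> A" using B K L(1) by (simp add: A_def)
  have "J (\<lambda>x. t3 x - ?t x) \<le> 0"
  proof (rule field_le_epsilon)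
    fix e :: real assume "0 < e"
    then have "J (\<lambda>x. t3 x - ?t x) \<le> A * (e / (A + 1))" using A by (intro le) auto
    also have "\<dots> \<le> e" using A \<open>0 < e\<close> by (simp add: field_simps)
    finally show "J (\<lambda>x. t3 x - ?t x) \<le> 0 + e" by simp
  qed
  moreover have "(\<lambda>x. t3 x - ?t x) \<in> Lp V p \<rho>" using tL by (intro Lp_diff Lp_comb)
  ultimately have "AE x in lebesgue_on V. t3 x - ?t x = 0"
    using Lp_energy_zeroD[OF p \<rho>(2)] by blast
  then show ?thesis by simp
qed

lemma tr_zero: "tr (\<lambda>_. 0) x = 0"
  using tr_comb[OF D_zero D_zero, of 0 0] by simp

text \<open>
  By linearity \<open>T u - tr v = T (u - v)\<close> almost everywhere for \<open>v\<close> in \<open>D\<close>, and \<open>T\<close> is bounded.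
\<close>

lemma bounded_operator_extends_trace:
  assumes T: "bounded_linear_Lp U X (\<lambda>u. N u powr (1 / p)) V p \<rho> T"
    and T_tr: "\<And>v. v \<in> D \<Longrightarrow> AE x in lebesgue_on V. T v x = tr v x"
  shows "\<exists>B. \<forall>u\<in>X. extends_trace B u (T u)"
proof -
  obtain B where TL: "\<And>u. u \<in> X \<Longrightarrow> T u \<in> Lp V p \<rho>"
    and T_add: "\<And>u v. u \<in> X \<Longrightarrow> v \<in> X \<Longrightarrow> AE x in lebesgue_on V. T (\<lambda>z. u z + v z) x = T u x + T v x"
    and T_scale: "\<And>c u. u \<in> X \<Longrightarrow> AE x in lebesgue_on V. T (\<lambda>z. c * u z) x = c * T u x"
    and T_bound: "\<And>u. u \<in> X \<Longrightarrow> Lp_norm V p \<rho> (T u) \<le> B * N u powr (1 / p)"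
    using T unfolding bounded_linear_Lp_def by blast
  \<comment> \<open>The bound \<open>B\<close> of an operator may be negative when the norm vanishes identically.\<close>
  let ?B = "max B 0 powr p"
  have J_T: "J (T u) \<le> ?B * N u" if "u \<in> X" for u
  proof -
    have "J (T u) powr (1 / p) \<le> max B 0 * N u powr (1 / p)"
      using T_bound[OF that] mult_right_mono[of B "max B 0" "N u powr (1 / p)"]
      by (simp add: Lp_norm_def Lp_energy_def)
    then have "(J (T u) powr (1 / p)) powr p \<le> (max B 0 * N u powr (1 / p)) powr p"
      using p by (intro powr_mono2) auto
    then show ?thesis
      using p N_nonneg Lp_energy_nonneg[OF \<rho>0] by (simp add: powr_powr powr_mult)
  qed
  have "extends_trace ?B u (T u)" if u: "u \<in> X" for u
    unfolding extends_trace_def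
  proof (intro conjI ballI)
    fix v assume v: "v \<in> D"
    have "(\<lambda>z. (-1) * v z) \<in> X" using X_comb[OF D_X[OF v] D_X[OF v], of "-1" 0] by simp
    from T_add[OF u this] T_scale[OF D_X[OF v], of "-1"] T_tr[OF v]
    have "AE x in lebesgue_on V. T u x - tr v x = T (\<lambda>z. u z - v z) x"
      by eventually_elim simp
    then have "J (\<lambda>x. T u x - tr v x) = J (T (\<lambda>z. u z - v z))"
      unfolding Lp_energy_def using TL[OF u] tr_Lp[OF v] TL[OF X_diff[OF u D_X[OF v]]] \<rho>(1)
      by (intro integral_cong_AE) (auto simp: Lp_def)
    also have "\<dots> \<le> ?B * N (\<lambda>z. u z - v z)" by (intro J_T X_diff u D_X v)
    finally show "J (\<lambda>x. T u x - tr v x) \<le> ?B * N (\<lambda>z. u z - v z)" .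
  qed (use TL[OF u] in auto)
  then show ?thesis by blast
qed

theorem unique_extension:
  "\<exists>T. (bounded_linear_Lp U X (\<lambda>u. N u powr (1 / p)) V p \<rho> T \<and>
        (\<forall>v\<in>D. AE x in lebesgue_on V. T v x = tr v x)) \<and>
       (\<forall>T'. bounded_linear_Lp U X (\<lambda>u. N u powr (1 / p)) V p \<rho> T' \<and>
             (\<forall>v\<in>D. AE x in lebesgue_on V. T' v x = tr v x) \<longrightarrow>
             (\<forall>u\<in>X. AE x in lebesgue_on V. T' u x = T u x))"
proof -
  define T where "T u = (SOME t. extends_trace (C * K) u t)" for u
  have T: "extends_trace (C * K) u (T u)" if "u \<in> X" for u
    unfolding T_def using extends_trace_exists[OF that] by (rule someI_ex)
  have XS: "u \<in> S" if "u \<in> X" for u using that by (simp add: X_def)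
  have "bounded_linear_Lp U X (\<lambda>u. N u powr (1 / p)) V p \<rho> T"
    unfolding bounded_linear_Lp_def
  proof (intro conjI ballI allI impI exI[of _ "(C * K) powr (1 / p)"])
    fix u assume u: "u \<in> X"
    show "T u \<in> Lp V p \<rho>" using T[OF u] by (simp add: extends_trace_def)
    have "J (T u) \<le> C * K * N u"
      using T[OF u] D_zero tr_zero unfolding extends_trace_def by force
    then have "J (T u) powr (1 / p) \<le> (C * K * N u) powr (1 / p)"
      using p Lp_energy_nonneg[OF \<rho>0] by (intro powr_mono2) auto
    then show "Lp_norm V p \<rho> (T u) \<le> (C * K) powr (1 / p) * N u powr (1 / p)"
      using C K N_nonneg by (simp add: Lp_norm_def Lp_energy_def powr_mult)
    show "AE x in lebesgue_on V. T (\<lambda>z. c * u z) x = c * T u x" for c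
    proof -
      have cu: "(\<lambda>z. c * u z) \<in> X" using X_comb[OF u u, of c 0] by simp
      show ?thesis
        using extends_trace_combination[OF u u XS[OF cu] T[OF u] T[OF u] T[OF cu], of c 0] by simp
    qed
    fix v assume v: "v \<in> X"
    show "AE x in lebesgue_on V. T u x = T v x" if "AE z in lebesgue_on U. u z = v z"
      using extends_trace_combination[OF v v XS[OF u] T[OF v] T[OF v] T[OF u], of 1 0] that by simp
    have uv: "(\<lambda>z. u z + v z) \<in> X" using X_comb[OF u v, of 1 1] by simp
    show "AE x in lebesgue_on V. T (\<lambda>z. u z + v z) x = T u x + T v x"
      using extends_trace_combination[OF u v XS[OF uv] T[OF u] T[OF v] T[OF uv], of 1 1] by simp
  qed
  moreover have "AE x in lebesgue_on V. T v x = tr v x" if v: "v \<in> D" for v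
  proof -
    have "J (\<lambda>x. T v x - tr v x) \<le> C * K * N (\<lambda>z. v z - v z)"
      using T[OF D_X[OF v]] v unfolding extends_trace_def by blast
    also have "N (\<lambda>z. v z - v z) = 0" using v by (intro N_null S_diff D_in_S) auto
    finally have "J (\<lambda>x. T v x - tr v x) \<le> 0" by simp
    moreover have "(\<lambda>x. T v x - tr v x) \<in> Lp V p \<rho>"
      using T[OF D_X[OF v]] tr_Lp[OF v] by (intro Lp_diff) (auto simp: extends_trace_def)
    ultimately have "AE x in lebesgue_on V. T v x - tr v x = 0"
      using Lp_energy_zeroD[OF p \<rho>(2)] by blast
    then show ?thesis by simp
  qed
  moreover have "AE x in lebesgue_on V. T' u x = T u x"
    if T': "bounded_linear_Lp U X (\<lambda>u. N u powr (1 / p)) V p \<rho> T'"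
      "\<forall>v\<in>D. AE x in lebesgue_on V. T' v x = tr v x" and u: "u \<in> X" for T' u
  proof -
    obtain B where B: "\<forall>u\<in>X. extends_trace B u (T' u)"
      using bounded_operator_extends_trace[OF T'(1)] T'(2) by blast
    show ?thesis
      using extends_trace_combination[OF u u XS[OF u] T[OF u] T[OF u] bspec[OF B u], of 1 0] by simp
  qed
  ultimately show ?thesis by blast
qed

end

section \<open>The weighted trace inequality on an interval\<close>

text \<open>
  The graph of a convex function lies above its tangent at \<open>m\<close>; the point \<open>X = 0\<close> is treated
  apart, being outside the open interval of differentiability.
\<close>

lemma powr_above_tangent:
  fixes X m p :: real
  assumes "1 \<le> p" "0 \<le> X" "0 < m"
  shows "m powr p + p * m powr (p - 1) * (X - m) \<le> X powr p"
proof (cases "X = 0")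
  case True
  have "m powr p = m powr (p - 1) * m" using assms(3) by (simp flip: powr_mult_base powr_add add: powr_minus powr_diff)
  moreover have "0 \<le> (p - 1) * (m powr (p - 1) * m)" using assms by simp
  ultimately show ?thesis using True assms by (simp add: algebra_simps)
next
  case False
  have "((\<lambda>x. x powr p) has_real_derivative p * m powr (p - 1)) (at m within {0<..})"
    using assms by (auto intro!: derivative_eq_intros)
  then have "p * m powr (p - 1) * (X - m) \<le> X powr p - m powr p"
    using assms False by (intro convex_on_imp_above_tangent[OF powr_convex]) (auto simp: interior_open)
  then show ?thesis by simp
qed

text \<open>
  Hoelder's inequality for the pair of conjugate weights \<open>t powr (- a * (p - 1))\<close> and
  \<open>t powr a\<close>. It is proved as Jensen's inequality for the measure \<open>t powr a dt\<close>: integrate the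
  tangent inequality at the mean value of \<open>\<bar>g t\<bar> * t powr (- a)\<close>, where the linear term
  integrates to \<open>0\<close>.
\<close>

lemma integral_power_le_weighted:
  fixes g :: "real \<Rightarrow> real"
  assumes p: "1 < p" and h: "0 < h" and a: "-1 < a"
    and g: "integrable (lebesgue_on {0<..<h}) (\<lambda>t. \<bar>g t\<bar>)"
    and A: "integrable (lebesgue_on {0<..<h}) (\<lambda>t. \<bar>g t\<bar> powr p * t powr (- a * (p - 1)))"
  shows "(LINT t|lebesgue_on {0<..<h}. \<bar>g t\<bar>) powr p \<le>
    (h powr (a + 1) / (a + 1)) powr (p - 1) *
    (LINT t|lebesgue_on {0<..<h}. \<bar>g t\<bar> powr p * t powr (- a * (p - 1)))"
proof -
  let ?M = "lebesgue_on {0<..<h}"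
  define I where "I = (LINT t|?M. \<bar>g t\<bar>)"
  define A' where "A' = (LINT t|?M. \<bar>g t\<bar> powr p * t powr (- a * (p - 1)))"
  define B where "B = h powr (a + 1) / (a + 1)"
  have B: "0 < B" using h a by (simp add: B_def)
  have "((\<lambda>t. t powr a) has_integral B) {0..h}"
    unfolding B_def using has_integral_powr_from_0[of a h] a h by simp
  then have hi: "((\<lambda>t. t powr a) has_integral B) {0<..<h}"
    by (simp add: has_integral_Icc_iff_Ioo)
  then have "(\<lambda>t. t powr a) absolutely_integrable_on {0<..<h}"
    by (intro nonnegative_absolutely_integrable_1) auto
  then have ia: "integrable ?M (\<lambda>t. t powr a)"
    by (rule absolutely_integrable_imp_integrable) simp
  have iaB: "(LINT t|?M. t powr a) = B"
    using lebesgue_integral_eq_integral[OF ia] hi by (simp add: integral_unique)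
  have "0 \<le> I" unfolding I_def by simp
  have "I powr p \<le> B powr (p - 1) * A'"
  proof (cases "I = 0")
    case True
    then show ?thesis unfolding A'_def by (auto intro!: mult_nonneg_nonneg)
  next
    case False
    \<comment> \<open>The mean value of \<open>\<bar>g t\<bar> * t powr (- a)\<close> with respect to \<open>t powr a dt\<close>.\<close>
    define m where "m = I / B"
    have m: "0 < m" using False \<open>0 \<le> I\<close> B by (simp add: m_def)
    let ?R = "\<lambda>t. m powr p * t powr a + p * m powr (p - 1) * (\<bar>g t\<bar> - m * t powr a)"
    have "(LINT t|?M. ?R t) \<le> A'"
      unfolding A'_def
    proof (rule integral_mono)
      show "integrable ?M ?R" using ia g by simp
      fix t assume "t \<in> space ?M"
      then have t: "0 < t" by (simp add: space_restrict_space)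
      define X where "X = \<bar>g t\<bar> * t powr (- a)"
      have "(m powr p + p * m powr (p - 1) * (X - m)) * t powr a \<le> X powr p * t powr a"
        using p m by (intro mult_right_mono powr_above_tangent) (auto simp: X_def)
      moreover have "X * t powr a = \<bar>g t\<bar>"
        using t by (simp add: X_def powr_minus field_simps)
      moreover have "X powr p * t powr a = \<bar>g t\<bar> powr p * t powr (- a * (p - 1))"
        using t by (simp add: X_def powr_mult powr_powr flip: powr_add) (simp add: algebra_simps)
      moreover have "(m powr p + p * m powr (p - 1) * (X - m)) * t powr a =
          m powr p * t powr a + p * m powr (p - 1) * (X * t powr a - m * t powr a)"
        by (simp add: algebra_simps)
      ultimately show "?R t \<le> \<bar>g t\<bar> powr p * t powr (- a * (p - 1))"
        by simp
    qed (fact A)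
    also have "(LINT t|?M. ?R t) = m powr p * B + p * m powr (p - 1) * (I - m * B)"
      using ia g by (simp add: iaB I_def)
    also have "\<dots> = m powr p * B" using B by (simp add: m_def)
    finally have "B powr (p - 1) * (m powr p * B) \<le> B powr (p - 1) * A'"
      by (intro mult_left_mono) auto
    moreover have "B powr (p - 1) * (m powr p * B) = I powr p"
    proof -
      have "B powr (p - 1) * B = B powr p" using B by (simp add: powr_diff)
      then have "B powr (p - 1) * (m powr p * B) = B powr p * m powr p" by (simp add: ac_simps)
      also have "\<dots> = I powr p" using B by (simp add: m_def flip: powr_mult)
      finally show ?thesis .
    qed
    ultimately show ?thesis by simp
  qed
  then show ?thesis by (simp add: I_def A'_def B_def)
qed

definition trace_const :: "real \<Rightarrow> real \<Rightarrow> real" where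
  "trace_const p h = 2 powr p * p powr p * (2 / h\<^sup>2)"

text \<open>
  With \<open>a = (2 * s - 1) / (p - 1)\<close> the dual weight \<open>t powr a\<close> has integral
  \<open>h powr (a + 1) / (a + 1)\<close>, and \<open>a + 1 = (p - 2 + 2 * s) / (p - 1)\<close>. The resulting power
  \<open>p - 1\<close> of \<open>1 / (p - 2 + 2 * s)\<close> is compensated by the factor on the left, which makes the
  constant independent of \<open>s\<close>.
\<close>

lemma one_dim_trace_integrable:
  fixes f g :: "real \<Rightarrow> real"
  assumes p: "2 \<le> p" and s: "0 < s" "s \<le> 1" and h: "0 < h" "h \<le> 1"
    and f: "continuous_on {0..h} f" and g: "continuous_on {0..h} g"
    and D: "\<And>t. 0 < t \<Longrightarrow> t < h \<Longrightarrow> (f has_real_derivative g t) (at t)"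
    and E: "integrable (lebesgue_on {0<..<h}) (\<lambda>t. (\<bar>f t\<bar> powr p + \<bar>g t\<bar> powr p) * t powr (1 - 2 * s))"
  shows "\<bar>f 0\<bar> powr p * (p - 2 + 2 * s) powr p \<le>
    trace_const p h * (LINT t|lebesgue_on {0<..<h}. (\<bar>f t\<bar> powr p + \<bar>g t\<bar> powr p) * t powr (1 - 2 * s))"
proof -
  let ?M = "lebesgue_on {0<..<h}" and ?\<kappa> = "p - 2 + 2 * s" and ?w = "\<lambda>t::real. t powr (1 - 2 * s)"
  define I where "I = (LINT t|?M. \<bar>g t\<bar>)"
  define F where "F = (LINT t|?M. \<bar>f t\<bar> powr p * ?w t)"
  define A where "A = (LINT t|?M. \<bar>g t\<bar> powr p * ?w t)"
  have \<kappa>: "0 < ?\<kappa>" "?\<kappa> \<le> p" using p s by auto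
  have mf: "f \<in> borel_measurable ?M" and mg: "g \<in> borel_measurable ?M"
    using f g by (auto intro!: continuous_imp_measurable_on_sets_lebesgue elim: continuous_on_subset)
  have mw: "?w \<in> borel_measurable ?M"
    by (intro measurable_restrict_space1 measurable_completion) measurable
  have iF: "integrable ?M (\<lambda>t. \<bar>f t\<bar> powr p * ?w t)"
    by (rule Bochner_Integration.integrable_bound[OF E])
       (use mf mw in \<open>auto intro!: mult_right_mono\<close>)
  have iA: "integrable ?M (\<lambda>t. \<bar>g t\<bar> powr p * ?w t)"
    by (rule Bochner_Integration.integrable_bound[OF E])
       (use mg mw in \<open>auto intro!: mult_right_mono\<close>)
  have FA: "F \<ge> 0" "A \<ge> 0" by (auto simp: F_def A_def)
  have EFA: "(LINT t|?M. (\<bar>f t\<bar> powr p + \<bar>g t\<bar> powr p) * ?w t) = F + A"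
    using iF iA by (simp add: F_def A_def distrib_right)
  have gabs: "(\<lambda>t. \<bar>g t\<bar>) integrable_on {0..h}"
    using g by (intro integrable_continuous_real continuous_intros)
  then have "(\<lambda>t. \<bar>g t\<bar>) absolutely_integrable_on {0<..<h}"
    by (intro nonnegative_absolutely_integrable_1) (auto simp: integrable_on_Icc_iff_Ioo)
  then have ig: "integrable ?M (\<lambda>t. \<bar>g t\<bar>)"
    by (rule absolutely_integrable_imp_integrable) simp
  have I_eq: "I = integral {0..h} (\<lambda>t. \<bar>g t\<bar>)"
    unfolding I_def by (subst lebesgue_integral_eq_integral[OF ig]) (auto simp: integral_open_interval_real)
  have "0 \<le> I" by (simp add: I_def)
  have f0: "\<bar>f 0\<bar> \<le> \<bar>f y\<bar> + I" if y: "0 < y" "y < h" for y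
  proof -
    have "(g has_integral (f y - f 0)) {0..y}"
    proof (rule fundamental_theorem_of_calculus_interior)
      show "continuous_on {0..y} f" using f y by (auto elim: continuous_on_subset)
      show "(f has_vector_derivative g t) (at t)" if "t \<in> {0<..<y}" for t
        using D[of t] that y by (simp add: has_real_derivative_iff_has_vector_derivative)
    qed (use y in simp)
    moreover have cy: "continuous_on {0..y} g" using g y by (auto elim: continuous_on_subset)
    ultimately have "\<bar>f y - f 0\<bar> \<le> integral {0..y} (\<lambda>t. \<bar>g t\<bar>)"
      using integral_norm_bound_integral[of g "{0..y}" "\<lambda>t. \<bar>g t\<bar>"]
      by (auto simp: integral_unique intro!: integrable_continuous_real continuous_intros)
    also have "\<dots> \<le> integral {0..h} (\<lambda>t. \<bar>g t\<bar>)"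
      using gabs cy y by (intro integral_subset_le) (auto intro!: integrable_continuous_real continuous_intros)
    finally show ?thesis using I_eq by linarith
  qed
  have iy: "((\<lambda>t. t) has_integral h\<^sup>2 / 2) {0<..<h}"
    using ident_has_integral[of 0 h] h by (simp add: has_integral_Icc_iff_Ioo)
  then have "(\<lambda>t. t) absolutely_integrable_on {0<..<h}"
    by (intro nonnegative_absolutely_integrable_1) auto
  then have ity: "integrable ?M (\<lambda>t. t)"
    by (rule absolutely_integrable_imp_integrable) simp
  have iyy: "(LINT t|?M. t) = h\<^sup>2 / 2"
    using lebesgue_integral_eq_integral[OF ity] iy by (simp add: integral_unique)
  \<comment> \<open>Averaging against \<open>y\<close> suits all exponents at once, as \<open>y \<le> y powr (1 - 2 * s)\<close> for \<open>y \<le> 1\<close>.\<close>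
  have "(LINT y|?M. \<bar>f 0\<bar> powr p * y) \<le> (LINT y|?M. 2 powr p * (\<bar>f y\<bar> powr p * ?w y + I powr p * y))"
  proof (rule integral_mono)
    show "integrable ?M (\<lambda>y. \<bar>f 0\<bar> powr p * y)" using ity by simp
    show "integrable ?M (\<lambda>y. 2 powr p * (\<bar>f y\<bar> powr p * ?w y + I powr p * y))" using ity iF by simp
    fix y assume "y \<in> space ?M"
    then have y: "0 < y" "y < h" by (auto simp: space_restrict_space)
    have "\<bar>f 0\<bar> powr p \<le> 2 powr p * (\<bar>f y\<bar> powr p + I powr p)"
      using powr_sum_le[of p "f 0" 1 "f y" 1 I] f0[OF y] p \<open>0 \<le> I\<close> by simp
    then have "\<bar>f 0\<bar> powr p * y \<le> (2 powr p * (\<bar>f y\<bar> powr p + I powr p)) * y"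
      using y by (intro mult_right_mono) auto
    also have "\<dots> = 2 powr p * (\<bar>f y\<bar> powr p * y powr 1 + I powr p * y)"
      using y by (simp add: algebra_simps)
    also have "\<dots> \<le> 2 powr p * (\<bar>f y\<bar> powr p * ?w y + I powr p * y)"
      using y h s by (intro mult_left_mono add_mono powr_mono') auto
    finally show "\<bar>f 0\<bar> powr p * y \<le> 2 powr p * (\<bar>f y\<bar> powr p * ?w y + I powr p * y)" .
  qed
  then have "\<bar>f 0\<bar> powr p * (h\<^sup>2 / 2) \<le> 2 powr p * (F + I powr p * (h\<^sup>2 / 2))"
    using ity iF by (simp add: iyy F_def)
  then have f0': "\<bar>f 0\<bar> powr p \<le> 2 powr p * (F * (2 / h\<^sup>2) + I powr p)"
    using h by (simp add: field_simps)
  define a where "a = (2 * s - 1) / (p - 1)"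
  have a1: "a + 1 = ?\<kappa> / (p - 1)" using p by (simp add: a_def field_simps)
  have am: "- a * (p - 1) = 1 - 2 * s" using p by (simp add: a_def)
  have "I powr p \<le> (h powr (a + 1) / (a + 1)) powr (p - 1) * A"
    using integral_power_le_weighted[of p h a g] ig iA p h a1 \<kappa> unfolding am I_def A_def
    by (smt (verit) divide_pos_pos)
  also have "(h powr (a + 1) / (a + 1)) powr (p - 1) \<le> (p / ?\<kappa>) powr (p - 1)"
  proof (intro powr_mono2)
    have "h powr (a + 1) \<le> 1" using h a1 \<kappa> p by (intro powr_le1) auto
    then have "h powr (a + 1) / (a + 1) \<le> 1 / (a + 1)" using a1 \<kappa> p by (intro divide_right_mono) auto
    also have "\<dots> \<le> p / ?\<kappa>" using a1 \<kappa> p by (simp add: divide_right_mono)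
    finally show "h powr (a + 1) / (a + 1) \<le> p / ?\<kappa>" .
    show "0 \<le> h powr (a + 1) / (a + 1)" using a1 \<kappa> p by simp
  qed (use p in simp)
  finally have Ip: "I powr p \<le> (p / ?\<kappa>) powr (p - 1) * A" using FA by (simp add: mult_right_mono)
  have "\<bar>f 0\<bar> powr p * ?\<kappa> powr p \<le> (2 powr p * (F * (2 / h\<^sup>2) + (p / ?\<kappa>) powr (p - 1) * A)) * ?\<kappa> powr p"
    using f0' Ip by (intro mult_right_mono order_trans[OF f0'] mult_left_mono add_left_mono) auto
  also have "\<dots> = 2 powr p * (F * (2 / h\<^sup>2) * ?\<kappa> powr p + ((p / ?\<kappa>) powr (p - 1) * ?\<kappa> powr p) * A)"
    by (simp add: algebra_simps)
  also have "\<dots> \<le> 2 powr p * (F * (2 / h\<^sup>2) * p powr p + (p powr p * (2 / h\<^sup>2)) * A)"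
  proof (intro mult_left_mono add_mono mult_right_mono)
    show "?\<kappa> powr p \<le> p powr p" using \<kappa> p by (intro powr_mono2) auto
    have "(p / ?\<kappa>) powr (p - 1) * ?\<kappa> powr p = p powr (p - 1) * ?\<kappa>"
      using p \<kappa> by (simp add: powr_divide powr_diff)
    also have "\<dots> \<le> p powr (p - 1) * p" using \<kappa> by (intro mult_left_mono) auto
    also have "\<dots> = p powr p" using p by (simp add: powr_diff)
    also have "\<dots> \<le> p powr p * (2 / h\<^sup>2)"
    proof -
      have "h\<^sup>2 \<le> 1" using h by (simp add: power_le_one)
      then have "1 \<le> 2 / h\<^sup>2" using h by (simp add: field_simps)
      then show ?thesis using mult_left_mono[of 1 "2 / h\<^sup>2" "p powr p"] by simp
    qed
    finally show "(p / ?\<kappa>) powr (p - 1) * ?\<kappa> powr p \<le> p powr p * (2 / h\<^sup>2)" .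
  qed (use FA in auto)
  also have "\<dots> = trace_const p h * (F + A)" by (simp add: trace_const_def algebra_simps add_divide_distrib)
  finally show ?thesis using EFA by simp
qed

lemma trace_const_pos: "0 < p \<Longrightarrow> 0 < h \<Longrightarrow> 0 < trace_const p h"
  by (simp add: trace_const_def)

text \<open>
  The same for integrals that may be infinite, as they are for \<open>s = 1\<close> whenever \<open>f 0 \<noteq> 0\<close>.
\<close>

lemma one_dim_trace:
  fixes f g :: "real \<Rightarrow> real"
  assumes p: "2 \<le> p" and s: "0 < s" "s \<le> 1" and h: "0 < h" "h \<le> 1"
    and f: "continuous_on {0..h} f" and g: "continuous_on {0..h} g"
    and D: "\<And>t. 0 < t \<Longrightarrow> t < h \<Longrightarrow> (f has_real_derivative g t) (at t)"
  shows "ennreal (\<bar>f 0\<bar> powr p * (p - 2 + 2 * s) powr p) \<le> ennreal (trace_const p h) *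
    (\<integral>\<^sup>+t. ennreal ((\<bar>f t\<bar> powr p + \<bar>g t\<bar> powr p) * t powr (1 - 2 * s)) \<partial>lebesgue_on {0<..<h})"
proof -
  let ?M = "lebesgue_on {0<..<h}" and ?E = "\<lambda>t. (\<bar>f t\<bar> powr p + \<bar>g t\<bar> powr p) * t powr (1 - 2 * s)"
  have c: "0 < trace_const p h" using p h by (intro trace_const_pos) auto
  show ?thesis
  proof (cases "(\<integral>\<^sup>+t. ennreal (?E t) \<partial>?M) = \<infinity>")
    case True
    then show ?thesis using c by (simp add: ennreal_mult_top)
  next
    case False
    have mf: "f \<in> borel_measurable ?M" and mg: "g \<in> borel_measurable ?M"
      using f g by (auto intro!: continuous_imp_measurable_on_sets_lebesgue elim: continuous_on_subset)
    have mw: "(\<lambda>t. t powr (1 - 2 * s)) \<in> borel_measurable ?M"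
      by (intro measurable_restrict_space1 measurable_completion) measurable
    have E: "integrable ?M ?E"
      using False mf mg mw by (intro integrableI_nonneg) (auto simp: less_top)
    then have "(\<integral>\<^sup>+t. ennreal (?E t) \<partial>?M) = ennreal (LINT t|?M. ?E t)"
      by (intro nn_integral_eq_integral) auto
    then show ?thesis
      using one_dim_trace_integrable[OF p s h f g D E] c by (simp add: ennreal_leI flip: ennreal_mult')
  qed
qed

lemma AE_lebesgue_on_iff: "open A \<Longrightarrow> (AE x in lebesgue_on A. P x) \<longleftrightarrow> (AE x in lborel. x \<in> A \<longrightarrow> P x)"
  by (subst AE_restrict_space_iff) (auto simp: AE_completion_iff)

text \<open>
  A null set times the whole space is a null set.
\<close>

lemma AE_lebesgue_on_fst:
  fixes \<Omega> :: "'a::euclidean_space set" and T :: "'b::euclidean_space set"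
  assumes "open \<Omega>" "open T" "AE x in lebesgue_on \<Omega>. P x"
  shows "AE z in lebesgue_on (\<Omega> \<times> T). P (fst z)"
proof -
  have "AE x in lborel. x \<in> \<Omega> \<longrightarrow> P x"
    using assms by (simp add: AE_lebesgue_on_iff)
  then obtain Z where Z: "Z \<in> null_sets lborel" "{x. \<not> (x \<in> \<Omega> \<longrightarrow> P x)} \<subseteq> Z"
    unfolding eventually_ae_filter by auto
  have "Z \<times> (UNIV :: 'b set) \<in> null_sets (lborel \<Otimes>\<^sub>M lborel)"
    using Z(1) by (intro lborel.times_in_null_sets1) auto
  then have "Z \<times> (UNIV :: 'b set) \<in> null_sets lborel" by (simp only: lborel_prod)
  then have "AE z in lborel. z \<in> \<Omega> \<times> T \<longrightarrow> P (fst z)"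
    by (rule AE_I') (use Z(2) in auto)
  then show ?thesis
    using assms by (simp add: AE_lebesgue_on_iff open_Times)
qed

text \<open>
  Coefficients are Lebesgue measurable only. Replacing them by Borel functions makes Tonelli's
  theorem applicable to functions of both variables.
\<close>

lemma borel_representative:
  fixes f :: "'a::euclidean_space \<Rightarrow> real"
  assumes "open A" "f \<in> borel_measurable (lebesgue_on A)"
  obtains f' where "f' \<in> borel_measurable borel" "AE x in lebesgue_on A. f x = f' x"
proof -
  have "(\<lambda>x. f x * indicator A x) \<in> borel_measurable lebesgue"
    using assms by (subst (asm) borel_measurable_restrict_space_iff) (auto simp: ac_simps)
  then obtain f' where f': "f' \<in> borel_measurable lborel" "AE x in lborel. f x * indicator A x = f' x"
    using completion_ex_borel_measurable_real by blast
  have "AE x in lborel. x \<in> A \<longrightarrow> f x = f' x"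
    using f'(2) by eventually_elim auto
  then show ?thesis
    using that[of f'] f'(1) assms(1) by (simp add: AE_lebesgue_on_iff)
qed

lemma borel_measurable_lebesgue_on_AE:
  fixes f g :: "'a::euclidean_space \<Rightarrow> real"
  assumes "open A" "f \<in> borel_measurable borel" "AE x in lebesgue_on A. f x = g x"
  shows "g \<in> borel_measurable (lebesgue_on A)"
proof -
  have "(\<lambda>x. f x * indicator A x) \<in> borel_measurable lebesgue"
    using assms(1,2) by (intro measurable_completion) auto
  moreover have "AE x in lebesgue. x \<in> A \<longrightarrow> f x = g x"
    using assms(1,3) by (subst (asm) AE_restrict_space_iff) auto
  then have "AE x in lebesgue. f x * indicator A x = g x * indicator A x"
    by eventually_elim auto
  ultimately have "(\<lambda>x. g x * indicator A x) \<in> borel_measurable lebesgue"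
    by (rule borel_measurable_AE)
  then show ?thesis
    using assms(1) by (subst borel_measurable_restrict_space_iff) (auto simp: ac_simps)
qed

lemma nn_integral_lebesgue_on_iterated_le:
  fixes F :: "('a::euclidean_space \<times> real) \<Rightarrow> ennreal"
  assumes "open \<Omega>" "open T" "open T'" "T' \<subseteq> T" and [measurable]: "F \<in> borel_measurable borel"
  shows "(\<integral>\<^sup>+x. (\<integral>\<^sup>+y. F (x, y) \<partial>lebesgue_on T') \<partial>lebesgue_on \<Omega>) \<le> (\<integral>\<^sup>+z. F z \<partial>lebesgue_on (\<Omega> \<times> T))"
proof -
  have [measurable]: "\<Omega> \<in> sets borel" "T \<in> sets borel" "T' \<in> sets borel" "\<Omega> \<times> T' \<in> sets borel" using assms by (auto intro!: borel_open open_Times)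
  have "(\<integral>\<^sup>+x. (\<integral>\<^sup>+y. F (x, y) \<partial>lebesgue_on T') \<partial>lebesgue_on \<Omega>) =
    (\<integral>\<^sup>+x. (\<integral>\<^sup>+y. F (x, y) * indicator (\<Omega> \<times> T') (x, y) \<partial>lborel) \<partial>lborel)"
    using assms by (simp add: nn_integral_restrict_space nn_integral_completion nn_integral_multc[symmetric])
      (intro nn_integral_cong, auto simp: indicator_def intro!: nn_integral_cong)
  also have "\<dots> = (\<integral>\<^sup>+z. F z * indicator (\<Omega> \<times> T') z \<partial>(lborel \<Otimes>\<^sub>M lborel))"
    by (rule lborel.nn_integral_fst) (simp add: lborel_prod)
  also have "\<dots> = (\<integral>\<^sup>+z. F z * indicator (\<Omega> \<times> T') z \<partial>lborel)" by (simp only: lborel_prod)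
  also have "\<dots> \<le> (\<integral>\<^sup>+z. F z * indicator (\<Omega> \<times> T) z \<partial>lborel)"
    using assms(4) by (intro nn_integral_mono mult_left_mono) (auto simp: indicator_def)
  also have "\<dots> = (\<integral>\<^sup>+z. F z \<partial>lebesgue_on (\<Omega> \<times> T))"
    using assms(1,2) by (simp add: nn_integral_restrict_space nn_integral_completion open_Times)
  finally show ?thesis .
qed

section \<open>The trace on a cylinder\<close>

text \<open>
  The estimates take place on the part \<open>{0<..h}\<close> of \<open>T\<close>. The set \<open>T\<close> is \<open>{0<..}\<close> for the
  infinite cylinder and \<open>{0<..<\<tau>}\<close> for the truncated one.
\<close>

locale weighted_cylinder =
  fixes \<Omega> :: "'a::euclidean_space set" and T :: "real set" and h p :: real
    and s G :: "'a \<Rightarrow> real"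
  assumes \<Omega>: "open \<Omega>" and T: "open T" "T \<subseteq> {0<..}" and h: "0 < h" "h \<le> 1" "{0<..h} \<subseteq> T"
    and p: "2 \<le> p"
    and s: "s \<in> borel_measurable (lebesgue_on \<Omega>)" "AE x in lebesgue_on \<Omega>. 0 < s x \<and> s x \<le> 1"
    and G: "weight \<Omega> G"
begin

abbreviation U :: "('a \<times> real) set" where "U \<equiv> \<Omega> \<times> T"
abbreviation U0 :: "('a \<times> real) set" where "U0 \<equiv> U \<union> \<Omega> \<times> {0}"
definition w :: "'a \<times> real \<Rightarrow> real" where "w = (\<lambda>(x, y). G x * y powr (1 - 2 * s x))"
definition w' :: "'a \<Rightarrow> real" where "w' = (\<lambda>x. G x * (p - 2 + 2 * s x) powr p)"

lemma open_U: "open U" using \<Omega> T by (intro open_Times)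

lemma base_subset_closure: "U0 \<subseteq> closure U"
proof -
  have "0 \<in> closure T"
  proof -
    have "closure {0<..<h} \<subseteq> closure T" using h by (intro closure_mono) auto
    then show ?thesis using h by auto
  qed
  then show ?thesis using closure_subset[of \<Omega>] closure_subset[of U] by (auto simp: closure_Times)
qed

lemma w'_measurable: "w' \<in> borel_measurable (lebesgue_on \<Omega>)"
  unfolding w'_def using s(1) G by (auto simp: weight_def)

lemma w'_pos: "AE x in lebesgue_on \<Omega>. 0 < w' x"
proof -
  have "AE x in lebesgue_on \<Omega>. 0 < G x" using G by (simp add: weight_def)
  with s(2) show ?thesis by eventually_elim (use p in \<open>simp add: w'_def\<close>)
qed

lemma w_nonneg: "AE z in lebesgue_on U. 0 \<le> w z"
proof -
  have "AE x in lebesgue_on \<Omega>. 0 < G x" using G by (simp add: weight_def)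
  from AE_lebesgue_on_fst[OF \<Omega> T(1) this] show ?thesis
    by eventually_elim (auto simp: w_def)
qed

lemma borel_coefficients:
  obtains G' s' where "G' \<in> borel_measurable borel" "s' \<in> borel_measurable borel"
    "AE x in lebesgue_on \<Omega>. G x = G' x \<and> s x = s' x"
proof -
  have mG: "G \<in> borel_measurable (lebesgue_on \<Omega>)" using G by (simp add: weight_def)
  obtain G' where G': "G' \<in> borel_measurable borel" "AE x in lebesgue_on \<Omega>. G x = G' x"
    using borel_representative[OF \<Omega> mG] .
  obtain s' where s': "s' \<in> borel_measurable borel" "AE x in lebesgue_on \<Omega>. s x = s' x"
    using borel_representative[OF \<Omega> s(1)] .
  show ?thesis by (rule that[OF G'(1) s'(1)]) (use G'(2) s'(2) in auto)
qed

lemma w_measurable: "w \<in> borel_measurable (lebesgue_on U)"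
proof -
  obtain G' s' where [measurable]: "G' \<in> borel_measurable borel" "s' \<in> borel_measurable borel"
    and ae: "AE x in lebesgue_on \<Omega>. G x = G' x \<and> s x = s' x"
    by (rule borel_coefficients)
  show ?thesis
  proof (rule borel_measurable_lebesgue_on_AE[OF open_U])
    show "(\<lambda>z. G' (fst z) * snd z powr (1 - 2 * s' (fst z))) \<in> borel_measurable borel"
      by (subst borel_prod[symmetric]) measurable
    show "AE z in lebesgue_on U. G' (fst z) * snd z powr (1 - 2 * s' (fst z)) = w z"
      using AE_lebesgue_on_fst[OF \<Omega> T(1) ae] by eventually_elim (auto simp: w_def)
  qed
qed

abbreviation C0 :: real where "C0 \<equiv> trace_const p h"

text \<open>
  Smoothness up to the closure makes \<open>v\<close> and its vertical derivative continuous on the closed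
  segment from the base to height \<open>h\<close>, as the estimate on an interval requires.
\<close>

lemma slice_trace:
  assumes v: "v \<in> test_functions_upto U U0" and x: "x \<in> \<Omega>" and sx: "0 < s x" "s x \<le> 1"
  shows "ennreal (\<bar>v (x, 0)\<bar> powr p * (p - 2 + 2 * s x) powr p) \<le> ennreal C0 *
    (\<integral>\<^sup>+t. ennreal ((\<bar>v (x, t)\<bar> powr p + \<bar>frechet_derivative v (at (x, t)) (0, 1)\<bar> powr p)
       * t powr (1 - 2 * s x)) \<partial>lebesgue_on {0<..<h})"
proof -
  have sm: "smooth_on U v" and cl: "continuous_on (closure U) v"
    using v by (auto simp: test_functions_upto_def smooth_on_closure_def)
  have L: "[(0, 1)] \<in> lists (Basis :: ('a \<times> real) set)" by (simp add: Basis_prod_def)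
  have "\<forall>is\<in>lists Basis. \<exists>g. continuous_on (closure U) g \<and> (\<forall>z\<in>U. g z = iter_deriv is v z)"
    using v by (simp add: test_functions_upto_def smooth_on_closure_def)
  from bspec[OF this L] obtain g where g: "continuous_on (closure U) g"
    "\<And>z. z \<in> U \<Longrightarrow> g z = frechet_derivative v (at z) (0, 1)"
    by auto
  have inU: "(x, t) \<in> U" if "0 < t" "t \<le> h" for t using x h that by auto
  have sub: "(\<lambda>t. (x, t)) ` {0..h} \<subseteq> closure U"
  proof (rule image_subsetI)
    fix t assume "t \<in> {0..h}"
    then have "(x, t) \<in> U0" using x inU[of t] by (cases "t = 0") auto
    then show "(x, t) \<in> closure U" using base_subset_closure by blast
  qed
  have cont: "continuous_on {0..h} (\<lambda>t. f (x, t))" if "continuous_on (closure U) f" for f :: "'a \<times> real \<Rightarrow> real"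
    by (rule continuous_on_compose2[OF that _ sub]) (auto intro!: continuous_intros)
  have D: "((\<lambda>t. v (x, t)) has_real_derivative g (x, t)) (at t)" if t: "0 < t" "t < h" for t
  proof -
    have "((\<lambda>t. (x, t)) has_derivative (\<lambda>h. (0, h))) (at t)"
      by (auto intro!: derivative_eq_intros)
    moreover have vd: "(v has_derivative frechet_derivative v (at (x, t))) (at (x, t))"
      using smooth_onD(1)[OF sm] inU t by simp
    ultimately have "((\<lambda>t. v (x, t)) has_derivative (\<lambda>h. frechet_derivative v (at (x, t)) (0, h))) (at t)"
      by (rule has_derivative_compose)
    moreover have "frechet_derivative v (at (x, t)) (0, h) = g (x, t) * h" for h
    proof -
      have "frechet_derivative v (at (x, t)) (h *\<^sub>R (0, 1)) = h * frechet_derivative v (at (x, t)) (0, 1)"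
        using has_derivative_linear[OF vd] by (simp add: linear_cmul del: scaleR_Pair)
      then show ?thesis using g(2)[of "(x, t)"] inU t by simp
    qed
    ultimately show ?thesis by (simp add: has_field_derivative_def)
  qed
  have "ennreal (\<bar>v (x, 0)\<bar> powr p * (p - 2 + 2 * s x) powr p) \<le> ennreal (trace_const p h) *
    (\<integral>\<^sup>+t. ennreal ((\<bar>v (x, t)\<bar> powr p + \<bar>g (x, t)\<bar> powr p) * t powr (1 - 2 * s x)) \<partial>lebesgue_on {0<..<h})"
    by (rule one_dim_trace[OF p sx h(1,2) cont[OF cl] cont[OF g(1)] D])
  also have "(\<integral>\<^sup>+t. ennreal ((\<bar>v (x, t)\<bar> powr p + \<bar>g (x, t)\<bar> powr p) * t powr (1 - 2 * s x)) \<partial>lebesgue_on {0<..<h}) =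
    (\<integral>\<^sup>+t. ennreal ((\<bar>v (x, t)\<bar> powr p + \<bar>frechet_derivative v (at (x, t)) (0, 1)\<bar> powr p)
       * t powr (1 - 2 * s x)) \<partial>lebesgue_on {0<..<h})"
    using g(2) inU by (intro nn_integral_cong) (auto simp: space_restrict_space)
  finally show ?thesis .
qed

text \<open>
  Tonelli's theorem applied to the slices; the vertical derivative is a component of the weak
  gradient.
\<close>

lemma trace_inequality_nn:
  assumes v: "v \<in> test_functions_upto U U0" and vS: "v \<in> sobolev U p w"
  shows "(\<integral>\<^sup>+x. ennreal (\<bar>v (x, 0)\<bar> powr p * w' x) \<partial>lebesgue_on \<Omega>) \<le> ennreal (C0 * energy U p w v)"
proof -
  have sm: "smooth_on U v" using v by (auto simp: test_functions_upto_def smooth_on_closure_def)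
  obtain G' s' where [measurable]: "G' \<in> borel_measurable borel" "s' \<in> borel_measurable borel"
    and ae: "AE x in lebesgue_on \<Omega>. G x = G' x \<and> s x = s' x"
    by (rule borel_coefficients)
  have C0: "0 < C0" using p h by (intro trace_const_pos) auto
  let ?D = "\<lambda>z. frechet_derivative v (at z) (0, 1)"
  have e: "(0, 1) \<in> (Basis :: ('a \<times> real) set)" by (simp add: Basis_prod_def)
  define v' where "v' z = indicator U z *\<^sub>R v z" for z
  define d' where "d' z = indicator U z *\<^sub>R ?D z" for z
  have [measurable]: "v' \<in> borel_measurable borel" "d' \<in> borel_measurable borel"
    unfolding v'_def d'_def
    by (intro borel_measurable_continuous_on_indicator borel_open open_U
        smooth_onD(2)[OF sm] smooth_onD(3)[OF sm e])+
  define F where "F z = ennreal (G' (fst z)) *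
    ennreal ((\<bar>v' z\<bar> powr p + \<bar>d' z\<bar> powr p) * snd z powr (1 - 2 * s' (fst z)))" for z
  have Fm: "F \<in> borel_measurable borel"
  proof -
    have fs: "fst \<in> borel_measurable (borel :: ('a \<times> real) measure)"
      "snd \<in> borel_measurable (borel :: ('a \<times> real) measure)"
      by (intro borel_measurable_continuous_onI continuous_intros)+
    have [measurable]: "(\<lambda>z. G' (fst z)) \<in> borel_measurable (borel :: ('a \<times> real) measure)"
      by (rule measurable_compose[OF fs(1)]) measurable
    have "(\<lambda>z. s' (fst z)) \<in> borel_measurable (borel :: ('a \<times> real) measure)"
      by (rule measurable_compose[OF fs(1)]) measurable
    then have [measurable]: "(\<lambda>z. snd z powr (1 - 2 * s' (fst z))) \<in> borel_measurable (borel :: ('a \<times> real) measure)"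
      by (intro powr_real_measurable fs(2)) auto
    show ?thesis unfolding F_def by measurable
  qed
  have inT: "t \<in> T" if "0 < t" "t < h" for t using h(3) that by auto
  have Gpos: "AE x in lebesgue_on \<Omega>. 0 < G x" using G by (simp add: weight_def)
  have "(\<integral>\<^sup>+x. ennreal (\<bar>v (x, 0)\<bar> powr p * w' x) \<partial>lebesgue_on \<Omega>) \<le>
    (\<integral>\<^sup>+x. (\<integral>\<^sup>+y. ennreal C0 * F (x, y) \<partial>lebesgue_on {0<..<h}) \<partial>lebesgue_on \<Omega>)"
  proof (rule nn_integral_mono_AE)
    have "AE x in lebesgue_on \<Omega>. x \<in> \<Omega>"
      using AE_space[of "lebesgue_on \<Omega>"] by (simp add: space_restrict_space)
    with s(2) Gpos ae show "AE x in lebesgue_on \<Omega>. ennreal (\<bar>v (x, 0)\<bar> powr p * w' x) \<le>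
      (\<integral>\<^sup>+y. ennreal C0 * F (x, y) \<partial>lebesgue_on {0<..<h})"
    proof eventually_elim
      case (elim x)
      let ?E = "\<lambda>t. ennreal ((\<bar>v' (x, t)\<bar> powr p + \<bar>d' (x, t)\<bar> powr p) * t powr (1 - 2 * s' x))"
      have "ennreal (\<bar>v (x, 0)\<bar> powr p * w' x) =
        ennreal (G' x) * ennreal (\<bar>v (x, 0)\<bar> powr p * (p - 2 + 2 * s x) powr p)"
        using elim by (simp add: w'_def mult_ac flip: ennreal_mult')
      also have "\<dots> \<le> ennreal (G' x) * (ennreal C0 *
        (\<integral>\<^sup>+t. ennreal ((\<bar>v (x, t)\<bar> powr p + \<bar>?D (x, t)\<bar> powr p)
          * t powr (1 - 2 * s x)) \<partial>lebesgue_on {0<..<h}))"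
        using elim by (intro mult_left_mono slice_trace[OF v]) auto
      also have "(\<integral>\<^sup>+t. ennreal ((\<bar>v (x, t)\<bar> powr p + \<bar>?D (x, t)\<bar> powr p)
          * t powr (1 - 2 * s x)) \<partial>lebesgue_on {0<..<h}) = (\<integral>\<^sup>+t. ?E t \<partial>lebesgue_on {0<..<h})"
        using elim inT by (intro nn_integral_cong) (auto simp: space_restrict_space v'_def d'_def)
      also have "ennreal (G' x) * (ennreal C0 * (\<integral>\<^sup>+t. ?E t \<partial>lebesgue_on {0<..<h})) =
        (\<integral>\<^sup>+t. ennreal C0 * F (x, t) \<partial>lebesgue_on {0<..<h})"
      proof -
        have "?E \<in> borel_measurable borel"
          by measurable
        then have "?E \<in> borel_measurable (lebesgue_on {0<..<h})"
          by (intro measurable_restrict_space1 measurable_completion) simp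
        then show ?thesis
          by (simp add: F_def nn_integral_cmult[symmetric] mult_ac)
      qed
      finally show ?case .
    qed
  qed
  also have "\<dots> \<le> (\<integral>\<^sup>+z. ennreal C0 * F z \<partial>lebesgue_on U)"
    using \<Omega> T h Fm by (intro nn_integral_lebesgue_on_iterated_le) auto
  also have "\<dots> = ennreal C0 * (\<integral>\<^sup>+z. F z \<partial>lebesgue_on U)"
    using Fm by (intro nn_integral_cmult measurable_restrict_space1 measurable_completion) simp
  also have "(\<integral>\<^sup>+z. F z \<partial>lebesgue_on U) \<le>
    (\<integral>\<^sup>+z. ennreal (\<bar>v z\<bar> powr p * w z + norm (weak_gradient U v z) powr p * w z) \<partial>lebesgue_on U)"
  proof (rule nn_integral_mono_AE)
    obtain g where g: "has_weak_gradient U v g" using vS by (auto simp: sobolev_def)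
    then have wg: "has_weak_gradient U v (weak_gradient U v)"
      unfolding weak_gradient_def by (metis someI)
    have "AE z in lebesgue_on U. z \<in> U"
      using AE_space[of "lebesgue_on U"] by (simp add: space_restrict_space)
    with AE_lebesgue_on_fst[OF \<Omega> T(1) ae] AE_lebesgue_on_fst[OF \<Omega> T(1) Gpos]
      weak_gradient_smooth[OF open_U sm wg e]
    show "AE z in lebesgue_on U. F z \<le>
      ennreal (\<bar>v z\<bar> powr p * w z + norm (weak_gradient U v z) powr p * w z)"
    proof eventually_elim
      case (elim z)
      have w0: "0 \<le> w z" using elim by (auto simp: w_def split: prod.split)
      have "F z = ennreal ((\<bar>v z\<bar> powr p + \<bar>?D z\<bar> powr p) * w z)"
        using elim by (auto simp: F_def v'_def d'_def w_def mult_ac split: prod.split simp flip: ennreal_mult')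
      also have "\<dots> \<le> ennreal ((\<bar>v z\<bar> powr p + norm (weak_gradient U v z) powr p) * w z)"
        using elim(3) Basis_le_norm[OF e, of "weak_gradient U v z"] p w0
        by (intro ennreal_leI mult_right_mono add_left_mono powr_mono2) auto
      finally show ?case by (simp add: distrib_right)
    qed
  qed
  also have "\<dots> = ennreal (energy U p w v)"
  proof -
    obtain g where g: "v \<in> Lp U p w" "has_weak_gradient U v g" "(\<lambda>z. norm (g z)) \<in> Lp U p w"
      using sobolevE[OF vS] .
    have iv: "integrable (lebesgue_on U) (\<lambda>z. \<bar>v z\<bar> powr p * w z)"
      using g(1) by (simp add: Lp_def)
    have wg: "has_weak_gradient U v (weak_gradient U v)"
      unfolding weak_gradient_def using g(2) by (metis someI)
    have m: "weak_gradient U v \<in> borel_measurable (lebesgue_on U)"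
      by (intro locally_integrable_measurable open_U has_weak_gradientD(2)[OF wg])
    have ig: "integrable (lebesgue_on U) (\<lambda>z. norm (weak_gradient U v z) powr p * w z)"
    proof (rule integrable_cong_AE_imp)
      show "integrable (lebesgue_on U) (\<lambda>z. norm (g z) powr p * w z)"
        using g(3) by (simp add: Lp_def)
      show "(\<lambda>z. norm (weak_gradient U v z) powr p * w z) \<in> borel_measurable (lebesgue_on U)"
        using m w_measurable by measurable
      show "AE z in lebesgue_on U. norm (g z) powr p * w z = norm (weak_gradient U v z) powr p * w z"
        using weak_gradient_AE[OF open_U g(2)] by eventually_elim simp
    qed
    have "AE z in lebesgue_on U. 0 \<le> \<bar>v z\<bar> powr p * w z + norm (weak_gradient U v z) powr p * w z"
      using w_nonneg by eventually_elim simp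
    with iv ig show ?thesis
      by (subst nn_integral_eq_integral) (auto simp: energy_def)
  qed
  finally show ?thesis
    using C0 energy_nonneg[OF w_nonneg] by (simp add: ennreal_mult mult_left_mono)
qed

lemma trace_inequality:
  assumes v: "v \<in> test_functions_upto U U0" and vS: "v \<in> sobolev U p w"
  shows "(\<lambda>x. v (x, 0)) \<in> Lp \<Omega> p w'" "Lp_energy \<Omega> p w' (\<lambda>x. v (x, 0)) \<le> C0 * energy U p w v"
proof -
  have "continuous_on \<Omega> (\<lambda>x. v (x, 0))"
  proof (rule continuous_on_compose2[of "closure U" v])
    show "continuous_on (closure U) v" using v by (simp add: test_functions_upto_def smooth_on_closure_def)
    show "(\<lambda>x. (x, 0)) ` \<Omega> \<subseteq> closure U" using base_subset_closure by auto
  qed (auto intro!: continuous_intros)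
  then have m: "(\<lambda>x. v (x, 0)) \<in> borel_measurable (lebesgue_on \<Omega>)"
    using \<Omega> by (intro continuous_imp_measurable_on_sets_lebesgue) auto
  have nn: "AE x in lebesgue_on \<Omega>. 0 \<le> \<bar>v (x, 0)\<bar> powr p * w' x"
    using w'_pos by eventually_elim simp
  have w'0: "AE x in lebesgue_on \<Omega>. 0 \<le> w' x"
    using w'_pos by eventually_elim simp
  have "integrable (lebesgue_on \<Omega>) (\<lambda>x. \<bar>v (x, 0)\<bar> powr p * w' x)"
  proof (rule integrableI_nonneg)
    show "(\<integral>\<^sup>+x. ennreal (\<bar>v (x, 0)\<bar> powr p * w' x) \<partial>lebesgue_on \<Omega>) < \<infinity>"
      using trace_inequality_nn[OF v vS] by (simp add: le_less_trans)
  qed (use m w'_measurable nn in auto)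
  then show L: "(\<lambda>x. v (x, 0)) \<in> Lp \<Omega> p w'" using m by (simp add: Lp_def)
  have "0 \<le> C0 * energy U p w v"
    using energy_nonneg[OF w_nonneg] trace_const_pos[of p h] p h by simp
  then show "Lp_energy \<Omega> p w' (\<lambda>x. v (x, 0)) \<le> C0 * energy U p w v"
    using trace_inequality_nn[OF v vS] nn_integral_Lp_energy[OF w'0 L] by simp
qed

sublocale trace: dense_bounded_map U \<Omega> p w' "sobolev U p w" "test_functions_upto U U0 \<inter> sobolev U p w"
  "energy U p w" "\<lambda>u x. u (x, 0)" "2 powr p" C0
proof
  show "open \<Omega>" "0 < p" "w' \<in> borel_measurable (lebesgue_on \<Omega>)" "AE x in lebesgue_on \<Omega>. 0 < w' x"
    using \<Omega> p w'_measurable w'_pos by auto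
  show "0 \<le> (2::real) powr p" "0 \<le> C0"
    using trace_const_pos[of p h] p h by auto
  show "0 \<le> energy U p w u" for u by (rule energy_nonneg[OF w_nonneg])
  have p0: "0 \<le> p" using p by simp
  note comb = sobolev_combination[OF open_U p0 w_measurable w_nonneg]
  show "(\<lambda>z. a * u z + b * v z) \<in> sobolev U p w"
    "energy U p w (\<lambda>z. a * u z + b * v z) \<le>
      2 powr p * (\<bar>a\<bar> powr p * energy U p w u + \<bar>b\<bar> powr p * energy U p w v)"
    if "u \<in> sobolev U p w" "v \<in> sobolev U p w" for u v a b
    using comb that by auto
  show "energy U p w u = 0" if "u \<in> sobolev U p w" "AE z in lebesgue_on U. u z = 0" for u
    using energy_AE_zero[OF open_U w_measurable] that by auto
  show "(\<lambda>z. a * u z + b * v z) \<in> test_functions_upto U U0 \<inter> sobolev U p w"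
    if "u \<in> test_functions_upto U U0 \<inter> sobolev U p w" "v \<in> test_functions_upto U U0 \<inter> sobolev U p w" for u v a b
    using that comb(1) test_functions_upto_combination[OF open_U] by auto
  show "(\<lambda>_. 0) \<in> test_functions_upto U U0 \<inter> sobolev U p w"
    using zero_in_test_functions_upto zero_in_sobolev by auto
  show "(\<lambda>x. u (x, 0)) \<in> Lp \<Omega> p w'"
    "Lp_energy \<Omega> p w' (\<lambda>x. u (x, 0)) \<le> C0 * energy U p w u"
    if "u \<in> test_functions_upto U U0 \<inter> sobolev U p w" for u
    using trace_inequality that by auto
qed auto

text \<open>
  Approximation in the norm and in its \<open>p\<close>-th power are the same.
\<close>

lemma X_eq_closure: "trace.X = sobolev_closure U U0 p w"
proof -
  have p0: "0 < p" using p by simp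
  have less: "sobolev_norm U p w u < \<epsilon> \<longleftrightarrow> energy U p w u < \<epsilon> powr p" if "0 < \<epsilon>" for u \<epsilon>
  proof -
    have "energy U p w u = (energy U p w u powr (1 / p)) powr p"
      using p0 energy_nonneg[OF w_nonneg] by (simp add: powr_powr)
    then show ?thesis
      using p0 that powr_less_cancel2[of p "energy U p w u powr (1 / p)" \<epsilon>]
        powr_less_mono2[of p "energy U p w u powr (1 / p)" \<epsilon>]
      unfolding sobolev_norm_eq by fastforce
  qed
  show ?thesis
  proof (intro set_eqI iffI)
    fix u assume "u \<in> trace.X"
    then show "u \<in> sobolev_closure U U0 p w"
      by (auto simp: trace.X_def sobolev_closure_def less)
  next
    fix u assume u: "u \<in> sobolev_closure U U0 p w"
    show "u \<in> trace.X"
      unfolding trace.X_def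
    proof (intro CollectI conjI allI impI)
      show "u \<in> sobolev U p w" using u by (simp add: sobolev_closure_def)
      fix \<epsilon> :: real assume \<epsilon>: "0 < \<epsilon>"
      then have "0 < \<epsilon> powr (1 / p)" by simp
      then obtain v where "v \<in> test_functions_upto U U0 \<inter> sobolev U p w"
        "sobolev_norm U p w (\<lambda>z. u z - v z) < \<epsilon> powr (1 / p)"
        using u unfolding sobolev_closure_def by blast
      then show "\<exists>v\<in>test_functions_upto U U0 \<inter> sobolev U p w. energy U p w (\<lambda>z. u z - v z) < \<epsilon>"
        using less[OF \<open>0 < \<epsilon> powr (1 / p)\<close>] \<epsilon> p0 by (auto simp: powr_powr)
    qed
  qed
qed

definition trace_on_cylinder :: "(('a \<times> real \<Rightarrow> real) \<Rightarrow> 'a \<Rightarrow> real) \<Rightarrow> bool" where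
  "trace_on_cylinder S \<longleftrightarrow>
     bounded_linear_Lp U (sobolev_closure U U0 p w) (sobolev_norm U p w) \<Omega> p w' S \<and>
     (\<forall>u \<in> sobolev_closure U U0 p w \<inter> test_functions_upto U U0.
        AE x in lebesgue_on \<Omega>. S u x = u (x, 0))"

theorem unique_trace:
  "\<exists>S. trace_on_cylinder S \<and>
     (\<forall>S'. trace_on_cylinder S' \<longrightarrow>
        (\<forall>u\<in>sobolev_closure U U0 p w. AE x in lebesgue_on \<Omega>. S' u x = S u x))"
proof -
  have "sobolev_closure U U0 p w \<inter> test_functions_upto U U0 = test_functions_upto U U0 \<inter> sobolev U p w"
    using trace.D_X unfolding X_eq_closure by (auto simp: sobolev_closure_def)
  moreover have "sobolev_norm U p w = (\<lambda>u. energy U p w u powr (1 / p))"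
    by (rule ext) (rule sobolev_norm_eq)
  ultimately show ?thesis
    using trace.unique_extension unfolding trace_on_cylinder_def X_eq_closure by simp
qed

end

theorem theorem5p1:
  fixes \<Omega> :: "(real ^ 'n) set"
    and p :: real
    and s G :: "real ^ 'n \<Rightarrow> real"
    and w :: "(real ^ 'n) \<times> real \<Rightarrow> real"
    and w' :: "real ^ 'n \<Rightarrow> real"
  assumes "\<Omega> \<noteq> {}" "bounded \<Omega>" "open \<Omega>" "lipschitz_boundary \<Omega>"
    and "2 \<le> p"
    and "s \<in> borel_measurable (lebesgue_on \<Omega>)"
    and "AE x in lebesgue_on \<Omega>. 0 \<le> s x \<and> s x \<le> 1"
    and "emeasure lebesgue {x \<in> \<Omega>. s x = 0} = 0"
    and "weight \<Omega> G"
    and "locally_integrable \<Omega> (\<lambda>x. G x powr (- 1 / (p - 1)))"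
    and "\<And>\<sigma>. 0 < \<sigma> \<Longrightarrow> \<sigma> < 1 \<Longrightarrow> (\<forall>x\<in>\<Omega>. s x = \<sigma>) \<Longrightarrow>
           (\<forall>x\<in>\<Omega>. G x = 2 powr (2 * \<sigma> - 1) * Gamma \<sigma> / Gamma (1 - \<sigma>))"
    and "w = (\<lambda>(x, y). G x * y powr (1 - 2 * s x))"
    and "w' = (\<lambda>x. G x * (p - 2 + 2 * s x) powr p)"
  shows "(\<exists>T. trace_operator \<Omega> p w w' T \<and>
            (\<forall>T'. trace_operator \<Omega> p w w' T' \<longrightarrow>
               (\<forall>u\<in>H0L \<Omega> p w. AE x in lebesgue_on \<Omega>. T' u x = T u x))) \<and>
         (\<forall>\<tau>>0. \<exists>T. trunc_trace_operator \<Omega> \<tau> p w w' T \<and>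
            (\<forall>T'. trunc_trace_operator \<Omega> \<tau> p w w' T' \<longrightarrow>
               (\<forall>u\<in>H0L_trunc \<Omega> \<tau> p w. AE x in lebesgue_on \<Omega>. T' u x = T u x)))"
proof -
  have "{x \<in> \<Omega>. s x = 0} = (s -` {0} \<inter> space (lebesgue_on \<Omega>))"
    by (auto simp: space_restrict_space)
  also have "\<dots> \<in> sets (lebesgue_on \<Omega>)"
    using assms(6) by (rule measurable_sets) simp
  finally have "{x \<in> \<Omega>. s x = 0} \<in> sets lebesgue"
    using assms(3) by (subst (asm) sets_restrict_space_iff) auto
  then have "{x \<in> \<Omega>. s x = 0} \<in> null_sets lebesgue"
    using assms(8) by (auto intro: null_setsI)
  then have "AE x in lebesgue. x \<notin> {x \<in> \<Omega>. s x = 0}" by (rule AE_not_in)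
  then have "AE x in lebesgue_on \<Omega>. s x \<noteq> 0"
    using assms(3) by (subst AE_restrict_space_iff) auto
  with assms(7) have s01: "AE x in lebesgue_on \<Omega>. 0 < s x \<and> s x \<le> 1"
    by eventually_elim auto
  have cyl: "weighted_cylinder \<Omega> T h p s G"
    if "open T" "T \<subseteq> {0<..}" "0 < h" "h \<le> 1" "{0<..h} \<subseteq> T" for T h
    using that assms(3,5,6,9) s01 by unfold_locales auto
  have w: "weighted_cylinder.w s G = w" "weighted_cylinder.w' p s G = w'"
    if "weighted_cylinder \<Omega> T h p s G" for T h
    using assms(12,13) weighted_cylinder.w_def[OF that] weighted_cylinder.w'_def[OF that] by simp_all
  show ?thesis
  proof (intro conjI allI impI)
    interpret weighted_cylinder \<Omega> "{0<..}" 1 p s G by (rule cyl) auto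
    note [simp] = w[OF weighted_cylinder_axioms]
    show "\<exists>T. trace_operator \<Omega> p w w' T \<and>
            (\<forall>T'. trace_operator \<Omega> p w w' T' \<longrightarrow>
               (\<forall>u\<in>H0L \<Omega> p w. AE x in lebesgue_on \<Omega>. T' u x = T u x))"
      using unique_trace
      by (simp add: trace_on_cylinder_def trace_operator_def H0L_def cylinder_base_def cylinder_def)
  next
    fix \<tau> :: real assume "0 < \<tau>"
    \<comment> \<open>The height \<open>\<tau> / 2\<close> leaves room below \<open>\<tau>\<close>, as the closed end of \<open>(0, h]\<close> has to lie in \<open>T\<close>.\<close>
    interpret weighted_cylinder \<Omega> "{0<..<\<tau>}" "min 1 (\<tau> / 2)" p s G
      by (rule cyl) (use \<open>0 < \<tau>\<close> in auto)
    note [simp] = w[OF weighted_cylinder_axioms]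
    show "\<exists>T. trunc_trace_operator \<Omega> \<tau> p w w' T \<and>
            (\<forall>T'. trunc_trace_operator \<Omega> \<tau> p w w' T' \<longrightarrow>
               (\<forall>u\<in>H0L_trunc \<Omega> \<tau> p w. AE x in lebesgue_on \<Omega>. T' u x = T u x))"
      using unique_trace
      by (simp add: trace_on_cylinder_def trunc_trace_operator_def H0L_trunc_def
          trunc_cylinder_base_def trunc_cylinder_def)
  qed
qed

end
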